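(* The number of maximal Hardy fields is equal to $2^{\mathfrak{c}}$, where $\mathfrak{c}=2^{\aleph_0}$.
   Context: A Hardy field is a subfield of the ring of germs at $+\infty$ of real-valued differentiable functions on intervals $(a,+\infty)$ that is closed under differentiation. A maximal Hardy field is a Hardy field not properly contained in any other Hardy field. *)

theory Defs
  imports "HOL-Analysis.Analysis" "HOL-Algebra.Subrings"
begin

unbundle cardinal_syntax

text \<open>
  A function on an interval \<open>(a, +\<infinity>)\<close> is represented by an arbitrary extension to a total function;
  the germ at \<open>+\<infinity>\<close> does not depend on the choice of the extension.
\<close>

definition germ_rel :: "(real \<Rightarrow> real) \<Rightarrow> (real \<Rightarrow> real) \<Rightarrow> bool"
  where "germ_rel f g \<longleftrightarrow> (\<forall>\<^sub>F x in at_top. f x = g x)"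

lemma germ_rel_equivp: "equivp germ_rel"
proof (rule equivpI)
  show "reflp germ_rel" by (auto simp: reflp_def germ_rel_def)
  show "symp germ_rel" by (auto simp: symp_def germ_rel_def elim: eventually_mono)
  show "transp germ_rel"
    unfolding transp_def germ_rel_def by (auto elim: eventually_elim2)
qed

quotient_type germ = "real \<Rightarrow> real" / germ_rel
  by (rule germ_rel_equivp)

instantiation germ :: comm_ring_1
begin

lift_definition zero_germ :: germ is "\<lambda>_. 0" .

lift_definition one_germ :: germ is "\<lambda>_. 1" .

lift_definition plus_germ :: "germ \<Rightarrow> germ \<Rightarrow> germ" is "\<lambda>f g x. f x + g x"
  unfolding germ_rel_def by (auto elim: eventually_elim2)

lift_definition minus_germ :: "germ \<Rightarrow> germ \<Rightarrow> germ" is "\<lambda>f g x. f x - g x"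
  unfolding germ_rel_def by (auto elim: eventually_elim2)

lift_definition uminus_germ :: "germ \<Rightarrow> germ" is "\<lambda>f x. - f x"
  unfolding germ_rel_def by (auto elim: eventually_mono)

lift_definition times_germ :: "germ \<Rightarrow> germ \<Rightarrow> germ" is "\<lambda>f g x. f x * g x"
  unfolding germ_rel_def by (auto elim: eventually_elim2)

instance
proof
  show "(0::germ) \<noteq> 1"
    by transfer (simp add: germ_rel_def)
qed (transfer; simp add: germ_rel_def algebra_simps)+

end

lift_definition differentiable_germ :: "germ \<Rightarrow> bool"
  is "\<lambda>f. \<forall>\<^sub>F x in at_top. f differentiable (at x)"
proof -
  have aux: "\<forall>\<^sub>F x in at_top. g differentiable (at x)"
    if fg: "germ_rel f g" and f: "\<forall>\<^sub>F x in at_top. f differentiable (at x)" for f g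
  proof -
    from fg f have "\<forall>\<^sub>F x in at_top. f x = g x \<and> f differentiable (at x)"
      unfolding germ_rel_def by (rule eventually_conj)
    then obtain a where a: "f x = g x \<and> f differentiable (at x)" if "x > a" for x
      unfolding eventually_at_top_dense by auto
    have "g differentiable (at x)" if "x > a" for x
    proof -
      obtain f' where "(f has_derivative f') (at x)"
        using a[OF \<open>x > a\<close>] by (auto simp: differentiable_def)
      then have "(g has_derivative f') (at x)"
        by (rule has_derivative_transform_within_open[where s = "{a<..}"]) (use a that in auto)
      then show ?thesis by (auto simp: differentiable_def)
    qed
    then show ?thesis unfolding eventually_at_top_dense by blast
  qed
  show "(\<forall>\<^sub>F x in at_top. f differentiable (at x)) = (\<forall>\<^sub>F x in at_top. g differentiable (at x))"
    if "germ_rel f g" for f g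
    using aux[of f g] aux[of g f] that germ_rel_equivp by (auto dest: equivp_symp)
qed

text \<open>Only meaningful on differentiable germs: \<open>deriv\<close> is underspecified elsewhere.\<close>

lift_definition germ_deriv :: "germ \<Rightarrow> germ" is deriv
proof -
  fix f g assume "germ_rel f g"
  then obtain a where a: "f x = g x" if "x > a" for x
    unfolding germ_rel_def eventually_at_top_dense by auto
  have "deriv f x = deriv g x" if "x > a" for x
    by (rule deriv_cong_ev)
      (use that a in \<open>auto simp: eventually_nhds intro!: exI[of _ "{a<..}"]\<close>)
  then show "germ_rel (deriv f) (deriv g)"
    unfolding germ_rel_def eventually_at_top_dense by blast
qed

definition differentiable_germ_ring :: "germ ring"
  where "differentiable_germ_ring =
    \<lparr>carrier = {g. differentiable_germ g}, monoid.mult = (*), one = 1, ring.zero = 0, add = (+)\<rparr>"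

lemma cring_differentiable_germ_ring: "cring differentiable_germ_ring"
proof -
  have closed:
    "differentiable_germ 0" "differentiable_germ 1"
    "differentiable_germ f \<Longrightarrow> differentiable_germ g \<Longrightarrow> differentiable_germ (f + g)"
    "differentiable_germ f \<Longrightarrow> differentiable_germ g \<Longrightarrow> differentiable_germ (f * g)"
    "differentiable_germ f \<Longrightarrow> differentiable_germ (- f)" for f g
    by (transfer; force elim: eventually_elim2 eventually_mono)+
  show ?thesis
    by (rule cringI)
      (auto intro!: abelian_groupI comm_monoidI simp: differentiable_germ_ring_def closed algebra_simps
        intro: exI[of _ "- x" for x] bexI[of _ "- x" for x])
qed

definition Hardy_field :: "germ set \<Rightarrow> bool"
  where "Hardy_field H \<longleftrightarrow>
    subfield H differentiable_germ_ring \<and> (\<forall>f\<in>H. germ_deriv f \<in> H)"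

definition maximal_Hardy_field :: "germ set \<Rightarrow> bool"
  where "maximal_Hardy_field H \<longleftrightarrow> Hardy_field H \<and> (\<nexists>K. Hardy_field K \<and> H \<subset> K)"

end

theory Submission
  imports Defs
begin

text \<open>
  The upper bound holds because a differentiable germ is determined by its values at rational points.

  For the lower bound, let \<open>Z\<close> solve the delay equation \<open>Z' x = Z x * Z (x - 1)\<close>. Then \<open>Z (x - 1)\<close> is
  the logarithmic derivative of \<open>Z\<close>, and \<open>Z\<close> grows faster than every power of \<open>Z (x - 1)\<close>. The germs of
  \<open>Z (r * x - k)\<close>, for real \<open>r > 0\<close> and natural \<open>k\<close>, are therefore linearly ordered by growth, each
  dominating all powers of the smaller ones, so every polynomial in them is asymptotic to its leading
  monomial. The algebra that they generate is closed under differentiation, hence its fractions form a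
  Hardy field. The same works if for each \<open>r\<close> one uses either \<open>Z\<close> or a second solution \<open>W\<close>.
  By a connectedness argument there are solutions \<open>Z\<close> and \<open>W\<close> that differ but meet in every interval
  of length 1, so no Hardy field contains both \<open>Z (r * x)\<close> and \<open>W (r * x)\<close>. The choice for each \<open>r\<close>
  thus yields \<open>2\<close> to the power of the continuum pairwise incompatible Hardy fields, and each of them
  extends to a maximal one by Zorn's lemma.
\<close>

section \<open>A delay differential equation\<close>

text \<open>Values up to \<open>a\<close> act as initial data, restricted only by continuity and the
  bound 1. This bound keeps logarithms available and forces slope at least 1 beyond
  \<open>a\<close>.\<close>

definition delay_solution :: "real \<Rightarrow> (real \<Rightarrow> real) \<Rightarrow> bool"
  where "delay_solution a Z \<longleftrightarrow> continuous_on UNIV Z \<and> (\<forall>x. 1 \<le> Z x) \<and>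
    (\<forall>x>a. (Z has_real_derivative Z x * Z (x - 1)) (at x))"

lemma delay_solution_ge_1: "delay_solution a Z \<Longrightarrow> 1 \<le> Z x"
  and delay_solution_pos: "delay_solution a Z \<Longrightarrow> 0 < Z x"
  and delay_solution_DERIV:
    "delay_solution a Z \<Longrightarrow> a < x \<Longrightarrow> (Z has_real_derivative Z x * Z (x - 1)) (at x)"
  and delay_solution_continuous: "delay_solution a Z \<Longrightarrow> continuous_on S Z"
  by (auto simp: delay_solution_def intro: continuous_on_subset less_le_trans[OF zero_less_one])

text \<open>Logarithms make the equation additive, so that comparing two solutions amounts to
  comparing their delayed values.\<close>

lemma delay_solution_DERIV_ln:
  assumes "delay_solution a Z" "a < x"
  shows "((\<lambda>x. ln (Z x)) has_real_derivative Z (x - 1)) (at x)"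
  using DERIV_chain2[OF DERIV_ln delay_solution_DERIV[OF assms]] delay_solution_pos[OF assms(1), of x]
  by (simp add: divide_simps less_imp_neq)

text \<open>The equation is autonomous. With \<open>c = 0\<close> the lemma merely raises the
  threshold.\<close>

lemma delay_solution_shift:
  assumes "delay_solution a Z" "a - c \<le> b"
  shows "delay_solution b (\<lambda>x. Z (x + c))"
proof -
  have "((\<lambda>x. Z (x + c)) has_real_derivative Z (x + c) * Z (x - 1 + c)) (at x)" if "b < x" for x
    using delay_solution_DERIV[OF assms(1), of "x + c"] assms(2) that
    by (simp add: DERIV_shift[of Z _ x c] diff_add_eq)
  moreover have "continuous_on UNIV (\<lambda>x. Z (x + c))"
    by (rule continuous_on_compose2[OF delay_solution_continuous[OF assms(1), of UNIV]])
      (auto intro!: continuous_intros)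
  ultimately show ?thesis using delay_solution_ge_1[OF assms(1)]
    by (auto simp: delay_solution_def)
qed

text \<open>Picard iteration; it becomes stationary because the delay is bounded away from 0.\<close>

primrec delay_iter :: "(real \<Rightarrow> real) \<Rightarrow> nat \<Rightarrow> real \<Rightarrow> real"
  where "delay_iter u 0 x = u x"
  | "delay_iter u (Suc n) x =
      (if x \<le> 1 then u x else u 1 * exp (integral {1..x} (\<lambda>t. delay_iter u n (t - 1))))"

text \<open>The fundamental theorem of calculus on a half-line, which near \<open>x\<close> agrees
  with a compact interval. The endpoint \<open>a\<close> is included because the iterates are glued
  there.\<close>

lemma integral_from_has_real_derivative:
  fixes v :: "real \<Rightarrow> real"
  assumes v: "continuous_on UNIV v" and "a \<le> x"
  shows "((\<lambda>x. integral {a..x} v) has_real_derivative v x) (at x within {a..})"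
proof -
  have "((\<lambda>x. integral {a..x} v) has_real_derivative v x) (at x within {a..x+1})"
    by (rule integral_has_real_derivative)
      (use assms(2) in \<open>auto intro: continuous_on_subset[OF v]\<close>)
  also have "at x within {a..x+1} = at x within {a..}"
    by (rule at_within_nhd[where S = "{x-1<..<x+1}"]) auto
  finally show ?thesis .
qed

lemma continuous_on_delay_iter:
  assumes "continuous_on UNIV u"
  shows "continuous_on UNIV (delay_iter u n)"
proof (induction n)
  case 0
  have "delay_iter u 0 = u" by (rule ext) simp
  then show ?case using assms by simp
next
  case (Suc n)
  let ?v = "\<lambda>t. delay_iter u n (t - 1)"
  have v: "continuous_on UNIV ?v"
    by (rule continuous_on_compose2[OF Suc]) (auto intro!: continuous_intros)
  have "continuous_on {1..} (\<lambda>x. integral {1..x} ?v)"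
    unfolding continuous_on_eq_continuous_within
    using integral_from_has_real_derivative[OF v] by (auto intro: DERIV_continuous)
  \<comment> \<open>The two branches agree at 1, where the integral runs over a single
    point.\<close>
  then have "continuous_on ({..1} \<union> {1..})
      (\<lambda>x. if x \<le> 1 then u x else u 1 * exp (integral {1..x} ?v))"
    by (intro continuous_on_If) (auto intro!: continuous_intros continuous_on_subset[OF assms])
  moreover have "{..1} \<union> {1..} = (UNIV :: real set)" by auto
  ultimately show ?case by simp
qed

text \<open>One iteration reads its predecessor only at arguments up to \<open>x - 1\<close>, so
  each iteration settles one more unit interval.\<close>

lemma delay_iter_stationary:
  assumes "x \<le> real n + 1" "n \<le> m"
  shows "delay_iter u m x = delay_iter u n x"
  using assms
proof (induction n arbitrary: x m)
  case 0
  then show ?case by (cases m) auto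
next
  case (Suc n)
  then obtain k where m: "m = Suc k" "n \<le> k" by (cases m) auto
  have "integral {1..x} (\<lambda>t. delay_iter u k (t - 1)) = integral {1..x} (\<lambda>t. delay_iter u n (t - 1))"
    by (rule integral_cong) (use Suc.IH[of _ k] Suc.prems m in auto)
  then show ?case by (simp add: m)
qed

text \<open>The settled values of the iterates satisfy the integrated equation, and differentiating
  it gives the delay equation. The last bound holds because the exponent is the integral of a
  positive function.\<close>

lemma exists_delay_solution:
  assumes u: "continuous_on UNIV u" and u1: "\<And>x. 1 \<le> u x"
  obtains Z where "delay_solution 1 Z" "\<And>x. x \<le> 1 \<Longrightarrow> Z x = u x" "\<And>x. 1 \<le> x \<Longrightarrow> u 1 \<le> Z x"
proof -
  define Z where "Z x = delay_iter u (nat \<lceil>x\<rceil>) x" for x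
  have Z_eq: "Z x = delay_iter u n x" if "x \<le> real n" for n x
    unfolding Z_def by (rule delay_iter_stationary[symmetric]) (use that in linarith)+
  have cont: "continuous_on UNIV Z"
    unfolding continuous_on_eq_continuous_within
  proof safe
    fix x :: real
    \<comment> \<open>The extra 1 makes \<open>x\<close> an interior point of a region on which
      \<open>Z\<close> is a single iterate.\<close>
    define n where "n = nat \<lceil>x\<rceil> + 1"
    have "continuous_on {..<real n} Z"
      using continuous_on_subset[OF continuous_on_delay_iter[OF u, of n]]
      by (rule continuous_on_eq) (auto simp: Z_eq[of _ n])
    moreover have "x \<in> {..<real n}"
      unfolding n_def by simp linarith
    ultimately show "continuous (at x) Z"
      by (simp add: continuous_on_eq_continuous_at)
  qed
  have le1: "Z x = u x" if "x \<le> 1" for x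
    using Z_eq[of x 1] that by simp
  have ge1: "Z x = u 1 * exp (integral {1..x} (\<lambda>t. Z (t - 1)))" if "1 \<le> x" for x
  proof -
    define n where "n = nat \<lceil>x\<rceil>"
    have x: "x \<le> real (Suc n)" unfolding n_def by linarith
    have "integral {1..x} (\<lambda>t. delay_iter u n (t - 1)) = integral {1..x} (\<lambda>t. Z (t - 1))"
      by (rule integral_cong) (use x in \<open>auto simp: Z_eq[of _ n]\<close>)
    then show ?thesis using Z_eq[OF x] that by auto
  qed
  have v: "continuous_on UNIV (\<lambda>t. Z (t - 1))"
    by (rule continuous_on_compose2[OF cont]) (auto intro!: continuous_intros)
  have pos: "0 < Z x" for x
    using le1[of x] ge1[of x] u1[of x] u1[of 1] by (cases "x \<le> 1") auto
  have u_le: "u 1 \<le> Z x" if "1 \<le> x" for x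
  proof -
    have "0 \<le> integral {1..x} (\<lambda>t. Z (t - 1))"
      by (rule integral_nonneg)
        (use pos v in \<open>auto intro!: integrable_continuous_real intro: continuous_on_subset less_imp_le\<close>)
    then show ?thesis
      unfolding ge1[OF that] using u1[of 1] by (simp add: mult_le_cancel_left1)
  qed
  have "(Z has_real_derivative Z x * Z (x - 1)) (at x)" if "1 < x" for x
  proof -
    let ?I = "\<lambda>x. integral {1..x} (\<lambda>t. Z (t - 1))"
    have "at x within {1..} = at x"
      using that by (intro at_within_interior) simp
    then have "(?I has_real_derivative Z (x - 1)) (at x)"
      using integral_from_has_real_derivative[OF v, of 1 x] that by simp
    then have "((\<lambda>x. u 1 * exp (?I x)) has_real_derivative u 1 * (exp (?I x) * Z (x - 1))) (at x)"
      by (intro DERIV_cmult DERIV_fun_exp)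
    then have "(Z has_real_derivative u 1 * (exp (?I x) * Z (x - 1))) (at x)"
      by (rule has_field_derivative_transform_within_open[where S = "{1<..}"])
        (use that in \<open>auto simp: ge1[symmetric]\<close>)
    then show ?thesis using ge1[of x] that by (simp add: mult.assoc)
  qed
  moreover have "1 \<le> Z x" for x
    using le1[of x] u_le[of x] u1[of x] u1[of 1] by (cases "x \<le> 1") auto
  ultimately have "delay_solution 1 Z"
    using cont by (auto simp: delay_solution_def)
  with le1 u_le that show thesis by blast
qed

section \<open>Growth of solutions\<close>

lemma delay_solution_mono:
  assumes Z: "delay_solution a Z" and "a < x" "x \<le> y"
  shows "Z x \<le> Z y"
proof (rule DERIV_nonneg_imp_nondecreasing[OF \<open>x \<le> y\<close>])
  fix t assume "x \<le> t" "t \<le> y"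
  then show "\<exists>d. (Z has_real_derivative d) (at t) \<and> 0 \<le> d"
    using delay_solution_DERIV[OF Z, of t] delay_solution_pos[OF Z] \<open>a < x\<close>
    by (intro exI[of _ "Z t * Z (t - 1)"]) (simp add: less_imp_le)
qed

text \<open>\<open>f x - x\<close> is eventually nondecreasing, so \<open>f\<close> stays above the
  identity plus a constant.\<close>

lemma filterlim_at_top_if_DERIV_ge_1:
  fixes f :: "real \<Rightarrow> real"
  assumes "\<forall>\<^sub>F x in at_top. \<exists>d\<ge>1. (f has_real_derivative d) (at x)"
  shows "filterlim f at_top at_top"
proof -
  obtain b where b: "\<And>x. b \<le> x \<Longrightarrow> \<exists>d\<ge>1. (f has_real_derivative d) (at x)"
    using assms by (auto simp: eventually_at_top_linorder)
  have "f b - b \<le> f x - x" if "b \<le> x" for x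
  proof (rule DERIV_nonneg_imp_nondecreasing[OF that])
    fix t assume "b \<le> t"
    then obtain d where "d \<ge> 1" "(f has_real_derivative d) (at t)" using b by blast
    then show "\<exists>d. ((\<lambda>x. f x - x) has_real_derivative d) (at t) \<and> 0 \<le> d"
      by (intro exI[of _ "d - 1"]) (auto intro!: derivative_eq_intros)
  qed
  then have "\<forall>\<^sub>F x in at_top. f b - b + x \<le> f x"
    by (auto simp: eventually_at_top_linorder algebra_simps intro!: exI[of _ b])
  then show ?thesis
    by (rule filterlim_at_top_mono[rotated])
      (rule filterlim_tendsto_add_at_top[OF tendsto_const filterlim_ident])
qed

lemma delay_solution_at_top:
  assumes Z: "delay_solution a Z"
  shows "filterlim Z at_top at_top"
proof (rule filterlim_at_top_if_DERIV_ge_1)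
  have "1 \<le> Z x * Z (x - 1)" for x
    using mult_mono[of 1 "Z x" 1 "Z (x - 1)"] delay_solution_ge_1[OF Z]
    by (metis mult_1 order.trans zero_le_one)
  then show "\<forall>\<^sub>F x in at_top. \<exists>d\<ge>1. (Z has_real_derivative d) (at x)"
    using delay_solution_DERIV[OF Z] unfolding eventually_at_top_dense by blast
qed

text \<open>By the mean value theorem, \<open>Z x / Z (x - 1) \<ge> exp (Z (x - 2))\<close>.\<close>

lemma delay_solution_ratio:
  assumes Z: "delay_solution a Z"
  shows "\<forall>\<^sub>F x in at_top. c * Z (x - 1) \<le> Z x"
proof -
  \<comment> \<open>\<open>max 1 c\<close> stands in for \<open>c\<close>, which may fail to be
    positive.\<close>
  have "\<forall>\<^sub>F x in at_top. ln (max 1 c) \<le> Z x"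
    using delay_solution_at_top[OF Z] by (auto simp: filterlim_at_top)
  then obtain b where b: "\<And>x. b \<le> x \<Longrightarrow> ln (max 1 c) \<le> Z x"
    by (auto simp: eventually_at_top_linorder)
  have "c * Z (x - 1) \<le> Z x" if x: "max a b + 2 < x" for x
  proof -
    have "\<exists>z. x - 1 < z \<and> z < x \<and> ln (Z x) - ln (Z (x - 1)) = (x - (x - 1)) * Z (z - 1)"
      by (rule MVT2) (use x in \<open>auto intro!: delay_solution_DERIV_ln[OF Z]\<close>)
    then obtain z where "x - 1 < z" "ln (Z x) - ln (Z (x - 1)) = Z (z - 1)" by auto
    moreover have "ln (max 1 c) \<le> Z (z - 1)" using b[of "z - 1"] x \<open>x - 1 < z\<close> by simp
    ultimately have "ln (max 1 c * Z (x - 1)) \<le> ln (Z x)"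
      using delay_solution_pos[OF Z, of "x - 1"] by (simp add: ln_mult)
    then have "max 1 c * Z (x - 1) \<le> Z x"
      using delay_solution_pos[OF Z] by (subst (asm) ln_le_cancel_iff) auto
    moreover have "c * Z (x - 1) \<le> max 1 c * Z (x - 1)"
      using delay_solution_pos[OF Z, of "x - 1"] by (intro mult_right_mono) auto
    ultimately show ?thesis by linarith
  qed
  then show ?thesis unfolding eventually_at_top_dense by blast
qed

text \<open>The logarithm of \<open>Z x / Z (x - 1) ^ n\<close> has derivative
  \<open>Z (x - 1) - n * Z (x - 2)\<close>. The ratio bound makes this eventually at least 1, so the
  logarithm tends to infinity.\<close>

lemma delay_solution_power_le:
  assumes Z: "delay_solution a Z"
  shows "\<forall>\<^sub>F x in at_top. Z (x - 1) ^ n \<le> Z x"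
proof -
  define g where "g x = ln (Z x) - real n * ln (Z (x - 1))" for x
  \<comment> \<open>The factor \<open>n + 1\<close> leaves a surplus
    \<open>Z (x - 2) \<ge> 1\<close> after \<open>n * Z (x - 2)\<close> is subtracted.\<close>
  have "\<forall>\<^sub>F x in at_top. (real n + 1) * Z (x - 1) \<le> Z x"
    by (rule delay_solution_ratio[OF Z])
  then have "\<forall>\<^sub>F x in at_top. (real n + 1) * Z (x - 1 - 1) \<le> Z (x - 1)"
    by (rule eventually_compose_filterlim)
      (simp add: filterlim_tendsto_add_at_top[OF tendsto_const[of "-1"] filterlim_ident, simplified])
  then have "\<forall>\<^sub>F x in at_top. \<exists>d\<ge>1. (g has_real_derivative d) (at x)"
    using eventually_gt_at_top[of "a + 1"]
  proof eventually_elim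
    case (elim x)
    have *: "((\<lambda>x. ln (Z (x - 1))) has_real_derivative Z (x - 1 - 1)) (at x)"
      using delay_solution_DERIV_ln[OF delay_solution_shift[OF Z order_refl, of "-1"], of x] elim
      by (simp add: algebra_simps)
    have "(g has_real_derivative Z (x - 1) - real n * Z (x - 1 - 1)) (at x)"
      unfolding g_def
      by (intro derivative_intros DERIV_cmult delay_solution_DERIV_ln[OF Z] *) (use elim in simp)
    moreover have "1 \<le> Z (x - 1) - real n * Z (x - 1 - 1)"
      using elim delay_solution_ge_1[OF Z, of "x - 1 - 1"] by (simp add: algebra_simps)
    ultimately show ?case by blast
  qed
  then have "filterlim g at_top at_top" by (rule filterlim_at_top_if_DERIV_ge_1)
  then have "\<forall>\<^sub>F x in at_top. 0 \<le> g x" by (auto simp: filterlim_at_top)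
  then show ?thesis
  proof eventually_elim
    case (elim x)
    then have "ln (Z (x - 1) ^ n) \<le> ln (Z x)"
      using delay_solution_pos[OF Z, of "x - 1"] by (simp add: g_def ln_realpow)
    then show ?case
      using delay_solution_pos[OF Z] by (subst (asm) ln_le_cancel_iff) auto
  qed
qed

section \<open>Comparison of solutions\<close>

text \<open>Method of steps: an inequality on one unit interval puts the logarithmic derivatives in
  the same order on the next, so the gap between the logarithms cannot shrink there.\<close>

lemma delay_solution_less_propagates:
  assumes F: "delay_solution a F" and G: "delay_solution a G" and "a \<le> b"
    and less: "\<forall>x\<in>{b..b+1}. F x < G x"
    and "b \<le> x"
  shows "F x < G x"
proof -
  have "\<forall>x. b \<le> x \<and> x \<le> b + 1 + real n \<longrightarrow> F x < G x" for n
  proof (induction n)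
    case 0
    then show ?case using less by simp
  next
    case (Suc n)
    have "F x < G x" if x: "b + 1 < x" "x \<le> b + 1 + real (Suc n)" for x
    proof -
      define g where "g t = ln (G t) - ln (F t)" for t
      have "g (b + 1) \<le> g x"
      proof (rule DERIV_nonneg_imp_nondecreasing[OF less_imp_le[OF x(1)]])
        fix t assume t: "b + 1 \<le> t" "t \<le> x"
        then have "F (t - 1) < G (t - 1)" using Suc x by auto
        moreover have "(g has_real_derivative G (t - 1) - F (t - 1)) (at t)"
          unfolding g_def using t \<open>a \<le> b\<close>
          by (intro derivative_intros delay_solution_DERIV_ln[OF F] delay_solution_DERIV_ln[OF G]) auto
        ultimately show "\<exists>d. (g has_real_derivative d) (at t) \<and> 0 \<le> d" by (auto intro: less_imp_le)
      qed
      moreover have "0 < g (b + 1)"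
        using bspec[OF less, of "b + 1"] delay_solution_pos[OF F, of "b + 1"] by (simp add: g_def)
      ultimately have "ln (F x) < ln (G x)" by (simp add: g_def)
      then show ?thesis
        using delay_solution_pos[OF F, of x] delay_solution_pos[OF G, of x] by simp
    qed
    then show ?case using less by (auto simp: not_le[symmetric])
  qed
  moreover have "x \<le> b + 1 + real (nat \<lceil>x - b\<rceil>)" by linarith
  ultimately show ?thesis using \<open>b \<le> x\<close> by blast
qed

text \<open>
  Equality propagates backwards too: by the differential equation, \<open>Z (x - 1)\<close> is the logarithmic
  derivative of \<open>Z\<close> at \<open>x\<close>.
\<close>

lemma delay_solution_eventually_eq:
  assumes Z: "delay_solution a Z" and W: "delay_solution b W"
    and eq: "\<forall>\<^sub>F x in at_top. Z x = W x" and "max a b - 1 < x"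
  shows "Z x = W x"
proof -
  obtain c where c: "\<And>x. c < x \<Longrightarrow> Z x = W x"
    using eq by (auto simp: eventually_at_top_dense)
  have "\<forall>x. max (max a b - 1) (c - real n) < x \<longrightarrow> Z x = W x" for n
  proof (induction n)
    case 0
    then show ?case using c by simp
  next
    case (Suc n)
    have "Z x = W x" if x: "max a b - 1 < x" "c - real (Suc n) < x" for x
    proof -
      have dZ: "(Z has_real_derivative Z (x + 1) * Z x) (at (x + 1))"
        using delay_solution_DERIV[OF Z, of "x + 1"] x by simp
      have "(W has_real_derivative W (x + 1) * W x) (at (x + 1))"
        using delay_solution_DERIV[OF W, of "x + 1"] x by simp
      then have "(Z has_real_derivative W (x + 1) * W x) (at (x + 1))"
        by (rule has_field_derivative_transform_within_open
            [where S = "{max (max a b - 1) (c - real n)<..}"]) (use x Suc in \<open>auto simp: not_le\<close>)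
      with dZ have "Z (x + 1) * Z x = W (x + 1) * W x" by (rule DERIV_unique)
      moreover have "max (max a b - 1) (c - real n) < x + 1" using x by auto
      then have "Z (x + 1) = W (x + 1)" using Suc by blast
      ultimately show ?thesis using delay_solution_pos[OF W, of "x + 1"] by simp
    qed
    then show ?case by simp
  qed
  moreover have "c - real (nat (\<lfloor>c - x\<rfloor> + 1)) < x" by linarith
  ultimately show ?thesis using \<open>max a b - 1 < x\<close> by (metis max_less_iff_conj)
qed

section \<open>Solutions that meet repeatedly\<close>

text \<open>Provides shifts of both kinds for the connectedness argument: a far enough translate of
  \<open>G\<close> lies above \<open>F\<close> on a given compact interval.\<close>

lemma delay_solution_gt_on_interval:
  assumes F: "delay_solution a F" and G: "delay_solution b G"
  obtains c where "d \<le> c" "\<And>x y. x \<in> {u..v} \<Longrightarrow> c \<le> y \<Longrightarrow> F x < G y"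
proof -
  have "bounded (F ` {u..v})"
    by (intro compact_imp_bounded compact_continuous_image delay_solution_continuous[OF F]) auto
  then obtain C where "\<forall>x\<in>{u..v}. \<bar>F x\<bar> \<le> C"
    by (auto simp: bounded_iff)
  then have C: "F x \<le> C" if "x \<in> {u..v}" for x using that abs_le_D1 by blast
  have "\<forall>\<^sub>F y in at_top. C < G y"
    using delay_solution_at_top[OF G] by (simp add: filterlim_at_top_dense)
  then obtain c where "\<And>y. c \<le> y \<Longrightarrow> C < G y"
    by (auto simp: eventually_at_top_linorder)
  with C that[of "max c d"] show thesis by (metis le_less_trans max.bounded_iff max.cobounded2)
qed

text \<open>For fixed \<open>b\<close>, the shifts that violate the inequality form the projection
  of a closed set along a compact interval, which is closed.\<close>

lemma open_ex_all_unit_interval: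
  fixes h :: "real \<times> real \<Rightarrow> real"
  assumes "continuous_on UNIV h"
  shows "open {t. \<exists>b>a. a < b + t \<and> (\<forall>x\<in>{b..b+1}. h (x, t) < 0)}"
proof -
  have "closed {t. \<exists>x. x \<in> {b..b+1} \<and> (x, t) \<in> {p. 0 \<le> h p}}" for b
    by (intro closed_compact_projection closed_Collect_le assms continuous_on_const) simp
  moreover have "{t. \<forall>x\<in>{b..b+1}. h (x, t) < 0} =
      - {t. \<exists>x. x \<in> {b..b+1} \<and> (x, t) \<in> {p. 0 \<le> h p}}" for b
    by (auto simp: not_le[symmetric])
  ultimately have "open {t. \<forall>x\<in>{b..b+1}. h (x, t) < 0}" for b
    by (simp only: open_Compl)
  moreover have "open {t. a < b + t}" for b
    by (intro open_Collect_less continuous_intros)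
  ultimately have "open (\<Union>b\<in>{a<..}. {t. a < b + t} \<inter> {t. \<forall>x\<in>{b..b+1}. h (x, t) < 0})"
    by (intro open_UN ballI open_Int)
  also have "\<dots> = {t. \<exists>b>a. a < b + t \<and> (\<forall>x\<in>{b..b+1}. h (x, t) < 0)}" by auto
  finally show ?thesis .
qed

text \<open>
  Being below (above) \<open>W\<close> on a unit interval is an open condition on the shift \<open>t\<close> and persists
  forever. Both conditions are met by some shifts, so by connectedness some shift meets neither.
\<close>

lemma exists_shift_meeting_repeatedly:
  assumes Z: "delay_solution 1 Z" and W: "delay_solution 1 W"
  shows "\<exists>t. \<forall>b. 1 < b \<longrightarrow> 1 < b + t \<longrightarrow> (\<exists>x\<in>{b..b+1}. Z (x + t) = W x)"
proof -
  define L where "L = {t. \<exists>b>1. 1 < b + t \<and> (\<forall>x\<in>{b..b+1}. Z (x + t) < W x)}"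
  define U where "U = {t. \<exists>b>1. 1 < b + t \<and> (\<forall>x\<in>{b..b+1}. W x < Z (x + t))}"
  have cont: "continuous_on UNIV (\<lambda>p::real \<times> real. Z (fst p + snd p))"
      "continuous_on UNIV (\<lambda>p::real \<times> real. W (fst p))"
    by (rule continuous_on_compose2[OF delay_solution_continuous[OF Z, of UNIV]]
        continuous_on_compose2[OF delay_solution_continuous[OF W, of UNIV]];
      auto intro!: continuous_intros)+
  have "open L"
    using open_ex_all_unit_interval[OF continuous_on_diff[OF cont], of 1] by (simp add: L_def)
  have "open U"
    using open_ex_all_unit_interval[OF continuous_on_diff[OF cont(2) cont(1)], of 1]
    by (simp add: U_def)
  have L: "\<forall>\<^sub>F x in at_top. Z (x + t) < W x" if t: "t \<in> L" for t
  proof -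
    obtain b where b: "b > 1" "1 < b + t" "\<forall>x\<in>{b..b+1}. Z (x + t) < W x"
      using t by (auto simp: L_def)
    have "delay_solution b (\<lambda>x. Z (x + t))" "delay_solution b W"
      using delay_solution_shift[OF Z, of t b] delay_solution_shift[OF W, of 0 b] b by auto
    from delay_solution_less_propagates[OF this order_refl b(3)] show ?thesis
      by (auto simp: eventually_at_top_linorder)
  qed
  have U: "\<forall>\<^sub>F x in at_top. W x < Z (x + t)" if t: "t \<in> U" for t
  proof -
    obtain b where b: "b > 1" "1 < b + t" "\<forall>x\<in>{b..b+1}. W x < Z (x + t)"
      using t by (auto simp: U_def)
    have "delay_solution b (\<lambda>x. Z (x + t))" "delay_solution b W"
      using delay_solution_shift[OF Z, of t b] delay_solution_shift[OF W, of 0 b] b by auto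
    from delay_solution_less_propagates[OF this(2,1) order_refl b(3)] show ?thesis
      by (auto simp: eventually_at_top_linorder)
  qed
  have "L \<inter> U = {}"
  proof (rule ccontr)
    assume "L \<inter> U \<noteq> {}"
    then obtain t where "t \<in> L" "t \<in> U" by auto
    from eventually_conj[OF L[OF this(1)] U[OF this(2)]]
    show False by (auto simp: eventually_at_top_linorder dest: less_asym)
  qed
  moreover have "L \<noteq> {}"
  proof -
    obtain c where "2 \<le> c" "\<And>x y. x \<in> {2..3} \<Longrightarrow> c \<le> y \<Longrightarrow> Z x < W y"
      by (rule delay_solution_gt_on_interval[OF Z W]) blast
    \<comment> \<open>With \<open>b = c\<close>, the shifted \<open>Z\<close> is evaluated on
      \<open>{2..3}\<close> and \<open>W\<close> at arguments from \<open>c\<close> on.\<close>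
    then have "2 - c \<in> L" unfolding L_def by (intro CollectI exI[of _ c]) auto
    then show ?thesis by blast
  qed
  moreover have "U \<noteq> {}"
  proof -
    obtain c where "2 \<le> c" "\<And>x y. x \<in> {2..3} \<Longrightarrow> c \<le> y \<Longrightarrow> W x < Z y"
      by (rule delay_solution_gt_on_interval[OF W Z]) blast
    then have "c - 2 \<in> U" unfolding U_def by (intro CollectI exI[of _ 2]) auto
    then show ?thesis by blast
  qed
  ultimately have "\<not> UNIV \<subseteq> L \<union> U"
    using connectedD[OF connected_UNIV \<open>open L\<close> \<open>open U\<close>] by auto
  then obtain t where t: "t \<notin> L" "t \<notin> U" by auto
  have "\<exists>x\<in>{b..b+1}. Z (x + t) = W x" if b: "1 < b" "1 < b + t" for b
  proof -
    have "\<exists>x\<in>{b..b+1}. \<not> Z (x + t) < W x" "\<exists>x\<in>{b..b+1}. \<not> W x < Z (x + t)"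
      using t b unfolding L_def U_def by blast+
    then obtain x y
      where xy: "x \<in> {b..b+1}" "W x \<le> Z (x + t)" "y \<in> {b..b+1}" "Z (y + t) \<le> W y"
      unfolding not_less by blast
    define h where "h x = Z (x + t) - W x" for x
    have "continuous_on {b..b+1} h"
      unfolding h_def by (intro continuous_on_diff delay_solution_continuous[OF W]
          delay_solution_continuous[OF delay_solution_shift[OF Z order_refl]])
    then have "connected (h ` {b..b+1})" by (rule connected_continuous_image) simp
    moreover have "h y \<le> 0" "0 \<le> h x" using xy by (auto simp: h_def)
    ultimately have "0 \<in> h ` {b..b+1}"
      using connectedD_interval xy by blast
    then show ?thesis by (auto simp: h_def)
  qed
  then show ?thesis by blast
qed

text \<open>
  The initial data are chosen so that the solutions are not shifts of one another: \<open>Z\<close> is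
  nondecreasing and attains its minimum 1, whereas \<open>W\<close> decreases on \<open>[0, 1/2]\<close> and is at least 2.
\<close>

lemma exists_delay_solutions_meeting_repeatedly:
  obtains a Z W where "delay_solution a Z" "delay_solution a W"
    "\<And>x. a \<le> x \<Longrightarrow> \<exists>y\<in>{x..x+1}. Z y = W y" "\<not> (\<forall>\<^sub>F x in at_top. Z x = W x)"
proof -
  obtain Z where Z: "delay_solution 1 Z" and Z1: "\<And>x. x \<le> 1 \<Longrightarrow> Z x = 1"
    by (rule exists_delay_solution[of "\<lambda>_. 1"]) auto
  obtain W where W: "delay_solution 1 W" and W1: "\<And>x. x \<le> 1 \<Longrightarrow> W x = 2 + \<bar>x - 1/2\<bar>"
    and W2: "\<And>x. 1 \<le> x \<Longrightarrow> 2 + \<bar>1 - 1/2\<bar> \<le> W x"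
    by (rule exists_delay_solution[of "\<lambda>x. 2 + \<bar>x - 1/2\<bar>"]) (auto intro!: continuous_intros)
  obtain t where t: "\<And>b. 1 < b \<Longrightarrow> 1 < b + t \<Longrightarrow> \<exists>x\<in>{b..b+1}. Z (x + t) = W x"
    using exists_shift_meeting_repeatedly[OF Z W] by blast
  \<comment> \<open>Beyond \<open>a\<close> both functions satisfy the equation, and
    \<open>1 < x\<close> and \<open>1 < x + t\<close> hold strictly, as the choice of
    \<open>t\<close> requires.\<close>
  define a where "a = max 1 (1 - t) + 1"
  have Zt: "delay_solution (1 - t) (\<lambda>x. Z (x + t))"
    by (rule delay_solution_shift[OF Z order_refl])
  have "\<not> (\<forall>\<^sub>F x in at_top. Z (x + t) = W x)"
  proof
    assume "\<forall>\<^sub>F x in at_top. Z (x + t) = W x"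
    note eq = delay_solution_eventually_eq[OF Zt W this]
    show False
    \<comment> \<open>Equality reaches back to every \<open>x > max 0 (- t)\<close>. For
      \<open>t \<ge> 0\<close> this covers 1/4 and 1/2, between which \<open>W\<close> drops;
      otherwise it covers \<open>1 - t\<close>, where the shifted \<open>Z\<close> equals 1.\<close>
    proof (cases "t \<ge> 0")
      case True
      have "Z (1/4 + t) \<le> Z (1/2 + t)"
        using delay_solution_mono[OF Z, of "1/4 + t" "1/2 + t"] Z1[of "1/4 + t"]
          delay_solution_ge_1[OF Z, of "1/2 + t"] by (cases "1 < 1/4 + t") auto
      then show False
        using eq[of "1/4"] eq[of "1/2"] W1[of "1/4"] W1[of "1/2"] True by simp
    next
      case False
      then show False using eq[of "1 - t"] Z1[of 1] W2[of "1 - t"] by simp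
    qed
  qed
  moreover have "delay_solution a (\<lambda>x. Z (x + t))" "delay_solution a W"
    using delay_solution_shift[OF Z, of t a] delay_solution_shift[OF W, of 0 a] by (auto simp: a_def)
  moreover have "\<exists>y\<in>{x..x+1}. Z (y + t) = W y" if "a \<le> x" for x
    using t[of x] that by (auto simp: a_def)
  ultimately show thesis using that by blast
qed

section \<open>Growth and polynomials\<close>

text \<open>All powers are required so that domination is inherited by products. The exponent 0
  forces \<open>h\<close> to be eventually at least 1.\<close>

definition dominates :: "(real \<Rightarrow> real) \<Rightarrow> (real \<Rightarrow> real) \<Rightarrow> bool"
  where "dominates h f \<longleftrightarrow> (\<forall>n. \<forall>\<^sub>F x in at_top. \<bar>f x\<bar> ^ n \<le> h x)"

lemma dominatesD: "dominates h f \<Longrightarrow> \<forall>\<^sub>F x in at_top. \<bar>f x\<bar> ^ n \<le> h x"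
  by (simp add: dominates_def)

lemma dominates_const:
  assumes "filterlim h at_top at_top"
  shows "dominates h (\<lambda>_. c)"
  using assms by (auto simp: dominates_def filterlim_at_top)

lemma dominates_mono:
  assumes "dominates h g" "\<forall>\<^sub>F x in at_top. \<bar>f x\<bar> \<le> \<bar>g x\<bar>"
  shows "dominates h f"
  unfolding dominates_def
proof
  fix n
  show "\<forall>\<^sub>F x in at_top. \<bar>f x\<bar> ^ n \<le> h x"
    using dominatesD[OF assms(1), of n] assms(2)
    by eventually_elim (meson abs_ge_zero order.trans power_mono)
qed

lemma dominates_trans:
  assumes "dominates u v" "dominates v w"
  shows "dominates u w"
  unfolding dominates_def
proof
  fix n
  show "\<forall>\<^sub>F x in at_top. \<bar>w x\<bar> ^ n \<le> u x"
    using dominatesD[OF assms(1), of 1] dominatesD[OF assms(2), of n]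
    by eventually_elim simp
qed

text \<open>Sums and products are bounded by twice this maximum and by its square, which reduces
  them to a single dominated function.\<close>

lemma dominates_max:
  assumes "dominates h f" "dominates h g"
  shows "dominates h (\<lambda>x. max \<bar>f x\<bar> \<bar>g x\<bar>)"
  unfolding dominates_def
proof
  fix n
  show "\<forall>\<^sub>F x in at_top. \<bar>max \<bar>f x\<bar> \<bar>g x\<bar>\<bar> ^ n \<le> h x"
    using dominatesD[OF assms(1), of n] dominatesD[OF assms(2), of n]
    by eventually_elim (simp add: max_def)
qed

lemma dominates_power:
  assumes "dominates h f"
  shows "dominates h (\<lambda>x. f x ^ k)"
  unfolding dominates_def
proof
  fix n
  show "\<forall>\<^sub>F x in at_top. \<bar>f x ^ k\<bar> ^ n \<le> h x"
    using dominatesD[OF assms, of "k * n"] by (simp add: power_abs power_mult)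
qed

lemma dominates_mult:
  assumes "dominates h f" "dominates h g"
  shows "dominates h (\<lambda>x. f x * g x)"
proof (rule dominates_mono[OF dominates_power[OF dominates_max[OF assms], of 2]], intro always_eventually allI)
  fix x
  have "\<bar>f x\<bar> * \<bar>g x\<bar> \<le> max \<bar>f x\<bar> \<bar>g x\<bar> * max \<bar>f x\<bar> \<bar>g x\<bar>"
    by (intro mult_mono) auto
  then show "\<bar>f x * g x\<bar> \<le> \<bar>(max \<bar>f x\<bar> \<bar>g x\<bar>)\<^sup>2\<bar>"
    by (simp add: abs_mult power2_eq_square)
qed

lemma dominates_add:
  assumes h: "filterlim h at_top at_top" and "dominates h f" "dominates h g"
  shows "dominates h (\<lambda>x. f x + g x)"
  by (rule dominates_mono[OF dominates_mult[OF dominates_const[OF h, of 2] dominates_max[OF assms(2,3)]]])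
    (intro always_eventually allI, auto simp: max_def)

text \<open>Domination of the square gives \<open>\<bar>f x\<bar> \<le> sqrt (h x)\<close>, so the
  quotient is at most \<open>1 / sqrt (h x)\<close> in absolute value.\<close>

lemma dominates_imp_ratio_tendsto_0:
  assumes h: "filterlim h at_top at_top" and "dominates h f"
  shows "((\<lambda>x. f x / h x) \<longlongrightarrow> 0) at_top"
proof -
  have "\<forall>\<^sub>F x in at_top. \<bar>f x\<bar> ^ 2 \<le> h x" by (rule dominatesD[OF assms(2)])
  moreover have "\<forall>\<^sub>F x in at_top. 1 \<le> h x" using h by (simp add: filterlim_at_top)
  ultimately have "\<forall>\<^sub>F x in at_top. norm (f x / h x) \<le> inverse (sqrt (h x))"
  proof eventually_elim
    case (elim x)
    have "\<bar>f x\<bar> \<le> sqrt (h x)" using elim by (intro real_le_rsqrt) simp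
    then have "\<bar>f x\<bar> * sqrt (h x) \<le> sqrt (h x) * sqrt (h x)"
      using elim by (intro mult_right_mono) auto
    then show ?case using elim by (simp add: field_simps)
  qed
  moreover have "((\<lambda>x. inverse (sqrt (h x))) \<longlongrightarrow> 0) at_top"
    by (intro tendsto_inverse_0_at_top filterlim_compose[OF sqrt_at_top h])
  ultimately show ?thesis by (rule Lim_null_comparison)
qed

section \<open>Polynomials in mutually comparable functions\<close>

text \<open>The real algebra generated by \<open>F\<close>, kept at the level of functions; germs
  enter only when fractions are formed.\<close>

inductive_set poly_alg :: "(real \<Rightarrow> real) set \<Rightarrow> (real \<Rightarrow> real) set" for F where
    const: "(\<lambda>_. c) \<in> poly_alg F"
  | gen: "f \<in> F \<Longrightarrow> f \<in> poly_alg F"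
  | add: "f \<in> poly_alg F \<Longrightarrow> g \<in> poly_alg F \<Longrightarrow> (\<lambda>x. f x + g x) \<in> poly_alg F"
  | mult: "f \<in> poly_alg F \<Longrightarrow> g \<in> poly_alg F \<Longrightarrow> (\<lambda>x. f x * g x) \<in> poly_alg F"

lemma poly_alg_mono:
  assumes "F \<subseteq> G" "f \<in> poly_alg F"
  shows "f \<in> poly_alg G"
  using assms(2,1) by induction (auto intro: poly_alg.intros)

text \<open>Allows a reduction to finitely many generators, among which a fastest growing one
  exists.\<close>

lemma poly_alg_finite:
  assumes "f \<in> poly_alg F"
  obtains G where "finite G" "G \<subseteq> F" "f \<in> poly_alg G"
proof -
  have "\<exists>G. finite G \<and> G \<subseteq> F \<and> f \<in> poly_alg G"
    using assms
  proof induction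
    case (const c)
    then show ?case by (intro exI[of _ "{}"]) (auto intro: poly_alg.const)
  next
    case (gen f)
    then show ?case by (intro exI[of _ "{f}"]) (auto intro: poly_alg.gen)
  next
    case (add f g)
    then obtain G H where "finite G" "G \<subseteq> F" "f \<in> poly_alg G" "finite H" "H \<subseteq> F" "g \<in> poly_alg H"
      by auto
    then show ?case
      by (intro exI[of _ "G \<union> H"]) (auto intro!: poly_alg.add elim: poly_alg_mono[rotated])
  next
    case (mult f g)
    then obtain G H where "finite G" "G \<subseteq> F" "f \<in> poly_alg G" "finite H" "H \<subseteq> F" "g \<in> poly_alg H"
      by auto
    then show ?case
      by (intro exI[of _ "G \<union> H"]) (auto intro!: poly_alg.mult elim: poly_alg_mono[rotated])
  qed
  then show thesis using that by blast
qed

lemma poly_alg_dominated: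
  assumes "f \<in> poly_alg F" and h: "filterlim h at_top at_top" and "\<And>u. u \<in> F \<Longrightarrow> dominates h u"
  shows "dominates h f"
  using assms(1)
  by induction (auto intro: dominates_const dominates_add dominates_mult h assms(3))

text \<open>Collecting powers of \<open>g\<close> separates one generator from the others, which
  prepares an induction on the set of generators.\<close>

lemma poly_alg_insert:
  assumes "f \<in> poly_alg (insert g F)"
  shows "\<exists>d a. (\<forall>j. a j \<in> poly_alg F) \<and> f = (\<lambda>x. \<Sum>j\<le>d. a j x * g x ^ j)" (is "?Q f")
proof -
  have add: "?Q (\<lambda>x. f1 x + f2 x)" if "?Q f1" "?Q f2" for f1 f2
  proof -
    obtain d a where a: "\<And>j. a j \<in> poly_alg F" "f1 = (\<lambda>x. \<Sum>j\<le>d. a j x * g x ^ j)" using \<open>?Q f1\<close> by blast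
    obtain e b where b: "\<And>j. b j \<in> poly_alg F" "f2 = (\<lambda>x. \<Sum>j\<le>e. b j x * g x ^ j)" using \<open>?Q f2\<close> by blast
    \<comment> \<open>Zero coefficients pad both sums to the common length
      \<open>max d e\<close>.\<close>
    define c where "c j = (\<lambda>x. (if j \<le> d then a j else (\<lambda>_. 0)) x + (if j \<le> e then b j else (\<lambda>_. 0)) x)" for j
    have "c j \<in> poly_alg F" for j
      unfolding c_def using a(1) b(1) poly_alg.const[of 0 F] by (intro poly_alg.add) auto
    moreover have "f1 x + f2 x = (\<Sum>j\<le>max d e. c j x * g x ^ j)" for x
    proof -
      have "f1 x = (\<Sum>j\<le>max d e. (if j \<le> d then a j else (\<lambda>_. 0)) x * g x ^ j)"
        unfolding a(2) by (rule sum.mono_neutral_cong_left) auto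
      moreover have "f2 x = (\<Sum>j\<le>max d e. (if j \<le> e then b j else (\<lambda>_. 0)) x * g x ^ j)"
        unfolding b(2) by (rule sum.mono_neutral_cong_left) auto
      ultimately show ?thesis by (simp add: c_def sum.distrib algebra_simps)
    qed
    ultimately show ?thesis by blast
  qed
  have monom: "?Q (\<lambda>x. b x * g x ^ k)" if b: "b \<in> poly_alg F" for b k
  proof -
    have "b x * g x ^ k = (\<Sum>j\<le>k. (if j = k then b else (\<lambda>_. 0)) x * g x ^ j)" for x
    proof -
      have "(\<Sum>j\<le>k. (if j = k then b else (\<lambda>_. 0)) x * g x ^ j) = (\<Sum>j\<le>k. if j = k then b x * g x ^ j else 0)"
        by (rule sum.cong) auto
      then show ?thesis by simp
    qed
    then show ?thesis using b poly_alg.const[of 0 F]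
      by (intro exI[of _ k] exI[of _ "\<lambda>j. if j = k then b else (\<lambda>_. 0)"]) auto
  qed
  have zero: "?Q (\<lambda>_. 0)"
    using monom[OF poly_alg.const[of 0], of 0] by simp
  have sum: "?Q (\<lambda>x. \<Sum>i\<in>I. p i x)" if "finite I" "\<And>i. i \<in> I \<Longrightarrow> ?Q (p i)" for I :: "nat set" and p
    using that
  proof (induction I)
    case empty
    then show ?case using zero by simp
  next
    case (insert i I)
    then show ?case using add[of "p i" "\<lambda>x. \<Sum>i\<in>I. p i x"] by simp
  qed
  show ?thesis using assms
  proof induction
    case (const c)
    then show ?case using monom[OF poly_alg.const[of c], of 0] by simp
  next
    case (gen f)
    then show ?case
      using monom[OF poly_alg.const[of 1], of 1] monom[OF poly_alg.gen[of f F], of 0] by auto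
  next
    case (add f1 f2)
    then show ?case using \<open>?Q f1 \<Longrightarrow> ?Q f2 \<Longrightarrow> _\<close> by blast
  next
    case (mult f1 f2)
    obtain d a where a: "\<And>j. a j \<in> poly_alg F" "f1 = (\<lambda>x. \<Sum>j\<le>d. a j x * g x ^ j)" using mult.IH(1) by blast
    obtain e b where b: "\<And>j. b j \<in> poly_alg F" "f2 = (\<lambda>x. \<Sum>j\<le>e. b j x * g x ^ j)" using mult.IH(2) by blast
    have "(\<lambda>x. f1 x * f2 x) = (\<lambda>x. \<Sum>i\<le>d. \<Sum>j\<le>e. (a i x * b j x) * g x ^ (i + j))"
      by (simp add: a(2) b(2) sum_product power_add mult_ac)
    moreover have "?Q \<dots>"
      by (intro sum monom poly_alg.mult a(1) b(1)) auto
    ultimately show ?case by simp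
  qed
qed

lemma exists_dominating_element:
  assumes "finite F" "F \<noteq> {}"
    and "\<And>u v. u \<in> F \<Longrightarrow> v \<in> F \<Longrightarrow> u \<noteq> v \<Longrightarrow> dominates u v \<or> dominates v u"
  shows "\<exists>g\<in>F. \<forall>u\<in>F - {g}. dominates g u"
  using assms
proof (induction F rule: finite_ne_induct)
  case (singleton x)
  then show ?case by simp
next
  case (insert x F)
  then obtain g where g: "g \<in> F" "\<forall>u\<in>F - {g}. dominates g u" by auto
  show ?case
  proof (cases "dominates g x")
    case True
    then show ?thesis using g by auto
  next
    case False
    then have "dominates x g" using insert.prems[of x g] insert.hyps g by auto
    then have "\<forall>u\<in>F. dominates x u" using g dominates_trans[of x g] by blast
    then show ?thesis by auto
  qed
qed

text \<open>
  A polynomial in \<open>g\<close> over germs that are small compared to \<open>g\<close> is asymptotic to its leading term.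
\<close>

lemma polynomial_zero_or_inverse_bound:
  fixes a :: "nat \<Rightarrow> real \<Rightarrow> real"
  assumes g: "filterlim g at_top at_top"
    and dom: "\<And>j. dominates g (a j)"
    and nz: "\<And>j. (\<forall>\<^sub>F x in at_top. a j x = 0) \<or>
      (\<forall>\<^sub>F x in at_top. a j x \<noteq> 0) \<and> dominates g (\<lambda>x. inverse (a j x))"
    and f: "f = (\<lambda>x. \<Sum>j\<le>d. a j x * g x ^ j)"
  shows "(\<forall>\<^sub>F x in at_top. f x = 0) \<or>
    (\<exists>k. (\<forall>\<^sub>F x in at_top. a k x \<noteq> 0) \<and>
      (\<forall>\<^sub>F x in at_top. f x \<noteq> 0 \<and> \<bar>inverse (f x)\<bar> \<le> \<bar>2 * inverse (a k x)\<bar>))"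
proof -
  define J where "J = {j. j \<le> d \<and> \<not> (\<forall>\<^sub>F x in at_top. a j x = 0)}"
  have "finite J" by (rule finite_subset[of _ "{..d}"]) (auto simp: J_def)
  have zero: "\<forall>\<^sub>F x in at_top. \<forall>j\<in>{..d} - J. a j x = 0"
    by (rule eventually_ball_finite) (auto simp: J_def)
  show ?thesis
  proof (cases "J = {}")
    case True
    have "\<forall>\<^sub>F x in at_top. f x = 0" using zero by eventually_elim (simp add: True f)
    then show ?thesis ..
  next
    case False
    \<comment> \<open>\<open>J\<close> omits the eventually vanishing coefficients, so
      \<open>k\<close> is the true degree in \<open>g\<close>.\<close>
    define k where "k = Max J"
    have k: "k \<in> J" "\<And>j. j \<in> J \<Longrightarrow> j \<le> k"
      using False \<open>finite J\<close> by (auto simp: k_def)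
    have ak: "\<forall>\<^sub>F x in at_top. a k x \<noteq> 0" "dominates g (\<lambda>x. inverse (a k x))"
      using nz[of k] k(1) by (auto simp: J_def)
    have g1: "\<forall>\<^sub>F x in at_top. 1 \<le> g x" using g by (simp add: filterlim_at_top)
    \<comment> \<open>The quotient of the \<open>j\<close>-th term by the leading term.\<close>
    define q where "q j x = a j x * inverse (a k x) * (g x ^ j / g x ^ k)" for j x
    have q_lim: "(q j \<longlongrightarrow> 0) at_top" if "j < k" for j
    proof (rule Lim_null_comparison)
      show "((\<lambda>x. \<bar>a j x * inverse (a k x) / g x\<bar>) \<longlongrightarrow> 0) at_top"
        by (intro tendsto_rabs_zero dominates_imp_ratio_tendsto_0 g dominates_mult dom ak)
      show "\<forall>\<^sub>F x in at_top. norm (q j x) \<le> \<bar>a j x * inverse (a k x) / g x\<bar>"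
        using g1
      proof eventually_elim
        case (elim x)
        have "g x ^ j / g x ^ k \<le> 1 / g x"
          using elim that power_increasing[of "Suc j" k "g x"] by (simp add: field_simps)
        moreover have "0 \<le> g x ^ j / g x ^ k" using elim by simp
        ultimately show ?case
          using mult_left_mono[of "g x ^ j / g x ^ k" "1 / g x" "\<bar>a j x * inverse (a k x)\<bar>"] elim
          by (simp add: q_def abs_mult)
      qed
    qed
    have "((\<lambda>x. 1 + (\<Sum>j<k. q j x)) \<longlongrightarrow> 1 + (\<Sum>j<k. 0)) at_top"
      by (intro tendsto_intros q_lim) auto
    then have "\<forall>\<^sub>F x in at_top. 1/2 < 1 + (\<Sum>j<k. q j x)"
      by (rule order_tendstoD) simp
    then have "\<forall>\<^sub>F x in at_top. f x \<noteq> 0 \<and> \<bar>inverse (f x)\<bar> \<le> \<bar>2 * inverse (a k x)\<bar>"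
      using zero g1 ak(1)
    proof eventually_elim
      case (elim x)
      define Q where "Q = 1 + (\<Sum>j<k. q j x)"
      have "f x = (\<Sum>j\<le>k. a j x * g x ^ j)"
        unfolding f by (rule sum.mono_neutral_right) (use k elim in \<open>auto simp: J_def\<close>)
      also have "\<dots> = (\<Sum>j<k. a j x * g x ^ j) + a k x * g x ^ k"
        by (simp add: lessThan_Suc_atMost[symmetric])
      also have "(\<Sum>j<k. a j x * g x ^ j) = (\<Sum>j<k. a k x * g x ^ k * q j x)"
        by (rule sum.cong) (use elim in \<open>auto simp: q_def\<close>)
      also have "\<dots> + a k x * g x ^ k = a k x * g x ^ k * Q"
        by (simp add: Q_def distrib_left sum_distrib_left)
      finally have fx: "f x = a k x * g x ^ k * Q" .
      have "\<bar>a k x\<bar> * 1 * (1/2) \<le> \<bar>a k x\<bar> * g x ^ k * Q"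
        by (intro mult_mono) (use elim in \<open>auto simp: Q_def intro: one_le_power\<close>)
      also have "\<dots> = \<bar>f x\<bar>" using elim by (simp add: fx abs_mult Q_def)
      finally have "\<bar>a k x\<bar> \<le> 2 * \<bar>f x\<bar>" by simp
      moreover have "f x \<noteq> 0" using calculation elim by auto
      ultimately show ?case using elim by (simp add: field_simps)
    qed
    then show ?thesis using ak(1) by blast
  qed
qed

text \<open>Induction that splits off the fastest generator \<open>g\<close>. The clause on inverses
  is the invariant: with \<open>h = g\<close> it says that a nonzero coefficient is too large to be
  compensated by a power of \<open>g\<close>.\<close>

lemma poly_alg_zero_or_inverse_dominated:
  assumes "finite F" and "\<And>u. u \<in> F \<Longrightarrow> filterlim u at_top at_top"
    and "\<And>u v. u \<in> F \<Longrightarrow> v \<in> F \<Longrightarrow> u \<noteq> v \<Longrightarrow> dominates u v \<or> dominates v u"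
    and "f \<in> poly_alg F"
  shows "(\<forall>\<^sub>F x in at_top. f x = 0) \<or> (\<forall>\<^sub>F x in at_top. f x \<noteq> 0) \<and>
    (\<forall>h. filterlim h at_top at_top \<longrightarrow> (\<forall>u\<in>F. dominates h u) \<longrightarrow> dominates h (\<lambda>x. inverse (f x)))"
  using assms
proof (induction F arbitrary: f rule: finite_psubset_induct)
  case (psubset F)
  show ?case
  proof (cases "F = {}")
    case True
    have "\<exists>c. f = (\<lambda>_. c)" using psubset.prems(3) unfolding True by induction auto
    then show ?thesis by (auto intro: dominates_const)
  next
    case False
    obtain g where g: "g \<in> F" and dom: "\<And>u. u \<in> F - {g} \<Longrightarrow> dominates g u"
      using exists_dominating_element[OF psubset.hyps False psubset.prems(2)] by blast
    define F' where "F' = F - {g}"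
    have "F = insert g F'" using g by (auto simp: F'_def)
    then obtain d a where a: "\<And>j. a j \<in> poly_alg F'" and f: "f = (\<lambda>x. \<Sum>j\<le>d. a j x * g x ^ j)"
      using poly_alg_insert psubset.prems(3) by blast
    have glim: "filterlim g at_top at_top" by (rule psubset.prems(1)[OF g])
    have IH: "(\<forall>\<^sub>F x in at_top. a j x = 0) \<or> (\<forall>\<^sub>F x in at_top. a j x \<noteq> 0) \<and>
      (\<forall>h. filterlim h at_top at_top \<longrightarrow> (\<forall>u\<in>F'. dominates h u) \<longrightarrow> dominates h (\<lambda>x. inverse (a j x)))"
      for j
      by (rule psubset.IH) (use g psubset.prems a in \<open>auto simp: F'_def\<close>)
    have "(\<forall>\<^sub>F x in at_top. a j x = 0) \<or>
      (\<forall>\<^sub>F x in at_top. a j x \<noteq> 0) \<and> dominates g (\<lambda>x. inverse (a j x))" for j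
      using IH[of j] glim dom by (auto simp: F'_def)
    moreover have "dominates g (a j)" for j
      by (rule poly_alg_dominated[OF a glim]) (use dom in \<open>auto simp: F'_def\<close>)
    ultimately consider "\<forall>\<^sub>F x in at_top. f x = 0"
      | k where "\<forall>\<^sub>F x in at_top. a k x \<noteq> 0"
        "\<forall>\<^sub>F x in at_top. f x \<noteq> 0 \<and> \<bar>inverse (f x)\<bar> \<le> \<bar>2 * inverse (a k x)\<bar>"
      using polynomial_zero_or_inverse_bound[OF glim _ _ f] by blast
    then show ?thesis
    proof cases
      case 1
      then show ?thesis ..
    next
      case 2
      have nz: "\<not> (\<forall>\<^sub>F x in at_top. a k x = 0)"
        using eventually_conj[OF 2(1)] by fastforce
      have "dominates h (\<lambda>x. inverse (f x))"
        if h: "filterlim h at_top at_top" "\<forall>u\<in>F. dominates h u" for h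
      proof -
        have "dominates h (\<lambda>x. inverse (a k x))"
          using IH[of k] nz h unfolding F'_def by blast
        from dominates_mult[OF dominates_const[OF h(1), of 2] this] show ?thesis
          by (rule dominates_mono) (use 2(2) in eventually_elim, simp)
      qed
      moreover have "\<forall>\<^sub>F x in at_top. f x \<noteq> 0" using 2(2) by eventually_elim simp
      ultimately show ?thesis by blast
    qed
  qed
qed

lemma poly_alg_zero_or_nonzero:
  assumes "\<And>u. u \<in> F \<Longrightarrow> filterlim u at_top at_top"
    and "\<And>u v. u \<in> F \<Longrightarrow> v \<in> F \<Longrightarrow> u \<noteq> v \<Longrightarrow> dominates u v \<or> dominates v u"
    and "f \<in> poly_alg F"
  shows "(\<forall>\<^sub>F x in at_top. f x = 0) \<or> (\<forall>\<^sub>F x in at_top. f x \<noteq> 0)"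
proof -
  obtain G where G: "finite G" "G \<subseteq> F" "f \<in> poly_alg G"
    using poly_alg_finite[OF assms(3)] .
  show ?thesis
    using poly_alg_zero_or_inverse_dominated[OF G(1) _ _ G(3)] assms(1,2) G(2) by blast
qed

lemma poly_alg_derivative:
  assumes "f \<in> poly_alg F"
    and "\<And>u. u \<in> F \<Longrightarrow> \<exists>v\<in>poly_alg F. \<forall>\<^sub>F x in at_top. (u has_real_derivative v x) (at x)"
  shows "\<exists>g\<in>poly_alg F. \<forall>\<^sub>F x in at_top. (f has_real_derivative g x) (at x)"
  using assms(1)
proof induction
  case (const c)
  then show ?case by (intro bexI[of _ "\<lambda>_. 0"] poly_alg.const) simp
next
  case (gen u)
  then show ?case by (rule assms(2))
next
  case (add f g)
  then obtain f' g' where "f' \<in> poly_alg F" "g' \<in> poly_alg F"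
    and *: "\<forall>\<^sub>F x in at_top. (f has_real_derivative f' x) (at x)"
      "\<forall>\<^sub>F x in at_top. (g has_real_derivative g' x) (at x)" by blast
  then show ?case
    by (intro bexI[of _ "\<lambda>x. f' x + g' x"] poly_alg.add eventually_elim2[OF *] DERIV_add)
next
  case (mult f g)
  then obtain f' g' where "f' \<in> poly_alg F" "g' \<in> poly_alg F"
    and *: "\<forall>\<^sub>F x in at_top. (f has_real_derivative f' x) (at x)"
      "\<forall>\<^sub>F x in at_top. (g has_real_derivative g' x) (at x)" by blast
  then show ?case using mult.hyps
    by (intro bexI[of _ "\<lambda>x. f' x * g x + g' x * f x"] poly_alg.add poly_alg.mult
        eventually_elim2[OF *] DERIV_mult)
qed

section \<open>Hardy fields\<close>

lemma ring_differentiable_germ_ring: "ring differentiable_germ_ring"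
  using cring_differentiable_germ_ring by (rule cring.axioms)

lemma differentiable_germ_ring_simps [simp]:
  "carrier differentiable_germ_ring = {g. differentiable_germ g}"
  "(\<otimes>\<^bsub>differentiable_germ_ring\<^esub>) = (*)" "\<one>\<^bsub>differentiable_germ_ring\<^esub> = 1"
  "\<zero>\<^bsub>differentiable_germ_ring\<^esub> = 0" "(\<oplus>\<^bsub>differentiable_germ_ring\<^esub>) = (+)"
  by (simp_all add: differentiable_germ_ring_def)

lemma differentiable_germ_uminus: "differentiable_germ f \<Longrightarrow> differentiable_germ (- f)"
  by transfer (force elim: eventually_mono)

lemma a_inv_differentiable_germ_ring:
  "differentiable_germ f \<Longrightarrow> \<ominus>\<^bsub>differentiable_germ_ring\<^esub> f = - f"
  using abelian_group.minus_equality[of differentiable_germ_ring "- f" f]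
    ring_differentiable_germ_ring differentiable_germ_uminus[of f]
  by (simp add: ring.is_abelian_group)

text \<open>Translates the algebraic structures into plain closure conditions on germs, the form
  used from here on.\<close>

lemma Hardy_field_iff:
  "Hardy_field H \<longleftrightarrow> (\<forall>f\<in>H. differentiable_germ f \<and> - f \<in> H \<and> germ_deriv f \<in> H \<and>
      (f \<noteq> 0 \<longrightarrow> (\<exists>g\<in>H. f * g = 1)) \<and> (\<forall>g\<in>H. f + g \<in> H \<and> f * g \<in> H)) \<and> 1 \<in> H"
    (is "_ \<longleftrightarrow> ?R")
proof
  interpret R: ring differentiable_germ_ring by (rule ring_differentiable_germ_ring)
  assume H: "Hardy_field H"
  then have sf: "subfield H differentiable_germ_ring" by (simp add: Hardy_field_def)
  have sr: "subring H differentiable_germ_ring" by (rule subfieldE(1)[OF sf])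
  have diff: "differentiable_germ f" if "f \<in> H" for f
    using subringE(1)[OF sr] that by auto
  have "\<exists>g\<in>H. f * g = 1" if "f \<in> H" "f \<noteq> 0" for f
    using R.subfield_m_inv[OF sf, of f] that by auto
  then show ?R
    using H subringE[OF sr] diff
    by (auto simp: Hardy_field_def simp flip: a_inv_differentiable_germ_ring)
next
  interpret R: cring differentiable_germ_ring by (rule cring_differentiable_germ_ring)
  assume H: ?R
  have sr: "subring H differentiable_germ_ring"
    using H by (intro R.subringI) (auto simp: a_inv_differentiable_germ_ring)
  then have "subcring H differentiable_germ_ring"
    by (intro R.subcringI') auto
  moreover have "Units (differentiable_germ_ring\<lparr>carrier := H\<rparr>) = H - {0}"
    using H by (auto simp: Units_def mult.commute)
  ultimately have "subfield H differentiable_germ_ring"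
    by (intro R.subfieldI) simp_all
  then show "Hardy_field H" using H by (simp add: Hardy_field_def)
qed

text \<open>Zorn's lemma: the closure conditions pass to unions of nonempty chains.\<close>

lemma subset_maximal_Hardy_field:
  assumes "Hardy_field H"
  obtains M where "maximal_Hardy_field M" "H \<subseteq> M"
proof -
  have "\<exists>M\<in>{K. Hardy_field K \<and> H \<subseteq> K}. \<forall>X\<in>{K. Hardy_field K \<and> H \<subseteq> K}. M \<subseteq> X \<longrightarrow> X = M"
  proof (rule subset_Zorn_nonempty)
    show "{K. Hardy_field K \<and> H \<subseteq> K} \<noteq> {}" using assms by auto
  next
    fix \<C> assume C: "\<C> \<noteq> {}" "subset.chain {K. Hardy_field K \<and> H \<subseteq> K} \<C>"
    \<comment> \<open>Each closure condition starts from at most two elements, so it suffices that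
      two elements of the union lie in one member of the chain.\<close>
    have common: "\<exists>K\<in>\<C>. f \<in> K \<and> g \<in> K" if fg: "f \<in> \<Union>\<C>" "g \<in> \<Union>\<C>" for f g
    proof -
      obtain K L where KL: "K \<in> \<C>" "f \<in> K" "L \<in> \<C>" "g \<in> L" using fg by blast
      then have "K \<subseteq> L \<or> L \<subseteq> K" using C(2) by (auto simp: subset_chain_def)
      then show ?thesis using KL by blast
    qed
    have Hardy: "Hardy_field K" "H \<subseteq> K" if "K \<in> \<C>" for K
      using C(2) that by (auto simp: subset_chain_def)
    have "Hardy_field (\<Union>\<C>)"
      unfolding Hardy_field_iff
    proof (intro conjI ballI impI)
      fix f g assume "f \<in> \<Union>\<C>" "g \<in> \<Union>\<C>"
      then obtain K where "K \<in> \<C>" "f \<in> K" "g \<in> K" using common by blast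
      then show "f + g \<in> \<Union>\<C>" "f * g \<in> \<Union>\<C>"
        using Hardy(1)[of K] by (auto simp: Hardy_field_iff)
    next
      fix f assume "f \<in> \<Union>\<C>"
      then obtain K where K: "K \<in> \<C>" "f \<in> K" by blast
      then show "differentiable_germ f" "- f \<in> \<Union>\<C>" "germ_deriv f \<in> \<Union>\<C>"
        using Hardy(1)[of K] by (auto simp: Hardy_field_iff)
      assume "f \<noteq> 0"
      then have "\<exists>g\<in>K. f * g = 1" using K Hardy(1)[of K] by (simp add: Hardy_field_iff)
      then show "\<exists>g\<in>\<Union>\<C>. f * g = 1" using K(1) by blast
    next
      show "1 \<in> \<Union>\<C>" using C(1) Hardy(1) by (auto simp: Hardy_field_iff)
    qed
    then show "\<Union>\<C> \<in> {K. Hardy_field K \<and> H \<subseteq> K}" using C(1) Hardy(2) by blast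
  qed
  then obtain M where "M \<in> {K. Hardy_field K \<and> H \<subseteq> K}"
    and max: "\<forall>X\<in>{K. Hardy_field K \<and> H \<subseteq> K}. M \<subseteq> X \<longrightarrow> X = M"
    by (rule bexE)
  then have M: "Hardy_field M" "H \<subseteq> M" by simp_all
  have "\<not> (Hardy_field K \<and> M \<subset> K)" for K
    using bspec[OF max, of K] M(2) by auto
  then have "maximal_Hardy_field M" using M(1) by (simp add: maximal_Hardy_field_def)
  then show thesis using M(2) by (rule that)
qed

text \<open>A nonzero germ has an inverse in the field, which rules out zeros arbitrarily far
  out.\<close>

lemma Hardy_field_eventually_nonzero:
  assumes "Hardy_field H" "abs_germ f \<in> H" "\<not> (\<forall>\<^sub>F x in at_top. f x = 0)"
  shows "\<forall>\<^sub>F x in at_top. f x \<noteq> 0"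
proof -
  have "abs_germ f \<noteq> 0"
    using assms(3) by (simp add: zero_germ_def germ.abs_eq_iff germ_rel_def)
  then obtain G where "abs_germ f * G = 1" using assms(1,2) by (auto simp: Hardy_field_iff)
  then obtain g where "abs_germ f * abs_germ g = 1" by (metis Quotient3_germ Quotient3_abs_rep)
  then have "\<forall>\<^sub>F x in at_top. f x * g x = 1"
    by (simp add: times_germ.abs_eq one_germ_def germ.abs_eq_iff germ_rel_def)
  then show ?thesis by eventually_elim auto
qed

text \<open>By the dichotomy, the numerator of a nonzero fraction eventually has no zeros, so the
  reciprocal is again a fraction. The quotient rule gives closure under differentiation.\<close>

lemma Hardy_field_fractions:
  fixes A :: "(real \<Rightarrow> real) set"
  assumes const: "\<And>c. (\<lambda>_. c) \<in> A"
    and add: "\<And>f g. f \<in> A \<Longrightarrow> g \<in> A \<Longrightarrow> (\<lambda>x. f x + g x) \<in> A"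
    and mult: "\<And>f g. f \<in> A \<Longrightarrow> g \<in> A \<Longrightarrow> (\<lambda>x. f x * g x) \<in> A"
    and nonzero: "\<And>f. f \<in> A \<Longrightarrow> (\<forall>\<^sub>F x in at_top. f x = 0) \<or> (\<forall>\<^sub>F x in at_top. f x \<noteq> 0)"
    and deriv: "\<And>f. f \<in> A \<Longrightarrow> \<exists>g\<in>A. \<forall>\<^sub>F x in at_top. (f has_real_derivative g x) (at x)"
  shows "Hardy_field {abs_germ (\<lambda>x. f x / g x) | f g. f \<in> A \<and> g \<in> A \<and> (\<forall>\<^sub>F x in at_top. g x \<noteq> 0)}"
    (is "Hardy_field ?H")
proof -
  \<comment> \<open>Membership only needs an eventual identity, so zeros of denominators do no
    harm.\<close>
  have I: "abs_germ h \<in> ?H"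
    if "f \<in> A" "g \<in> A" "\<forall>\<^sub>F x in at_top. g x \<noteq> 0" "\<forall>\<^sub>F x in at_top. h x = f x / g x" for f g h
  proof -
    have "abs_germ h = abs_germ (\<lambda>x. f x / g x)"
      using that by (simp add: germ.abs_eq_iff germ_rel_def)
    then show ?thesis using that by blast
  qed
  show ?thesis
    unfolding Hardy_field_iff
  proof (intro conjI ballI impI)
    show "1 \<in> ?H"
      unfolding one_germ_def by (rule I[OF const[of 1] const[of 1]]) auto
  next
    fix p q assume "p \<in> ?H" "q \<in> ?H"
    then obtain f g h k where A: "f \<in> A" "g \<in> A" "h \<in> A" "k \<in> A"
      and nz: "\<forall>\<^sub>F x in at_top. g x \<noteq> 0" "\<forall>\<^sub>F x in at_top. k x \<noteq> 0"
      and pq: "p = abs_germ (\<lambda>x. f x / g x)" "q = abs_germ (\<lambda>x. h x / k x)" by blast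
    have gk: "\<forall>\<^sub>F x in at_top. g x * k x \<noteq> 0" using nz by eventually_elim simp
    show "p + q \<in> ?H" unfolding pq plus_germ.abs_eq
      by (rule I[OF add[OF mult[OF A(1,4)] mult[OF A(3,2)]] mult[OF A(2,4)] gk])
        (use nz in eventually_elim, simp add: add_frac_eq)
    show "p * q \<in> ?H" unfolding pq times_germ.abs_eq
      by (rule I[OF mult[OF A(1,3)] mult[OF A(2,4)] gk]) simp
  next
    fix p assume "p \<in> ?H"
    then obtain f g where A: "f \<in> A" "g \<in> A" and nz: "\<forall>\<^sub>F x in at_top. g x \<noteq> 0"
      and p: "p = abs_germ (\<lambda>x. f x / g x)" by blast
    \<comment> \<open>Negation is multiplication by the constant -1; the quotient rule below is
      written accordingly.\<close>
    have um: "(\<lambda>x. - 1 * h x) \<in> A" if "h \<in> A" for h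
      by (rule mult[OF const that])
    show "- p \<in> ?H" unfolding p uminus_germ.abs_eq
      by (rule I[OF um[OF A(1)] A(2) nz]) simp
    obtain f' g' where A': "f' \<in> A" "g' \<in> A"
      and *: "\<forall>\<^sub>F x in at_top. (f has_real_derivative f' x) (at x)"
        "\<forall>\<^sub>F x in at_top. (g has_real_derivative g' x) (at x)"
      using deriv A by metis
    have D: "\<forall>\<^sub>F x in at_top. ((\<lambda>x. f x / g x) has_real_derivative
        (f' x * g x + (- 1 * (f x * g' x))) / (g x * g x)) (at x)"
      using * nz by eventually_elim (use DERIV_divide in \<open>force simp: algebra_simps\<close>)
    show "differentiable_germ p" unfolding p differentiable_germ.abs_eq
      using D by eventually_elim (auto simp: real_differentiable_def)
    show "germ_deriv p \<in> ?H" unfolding p germ_deriv.abs_eq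
    proof (rule I[OF add[OF mult[OF A'(1) A(2)] um[OF mult[OF A(1) A'(2)]]] mult[OF A(2,2)]])
      show "\<forall>\<^sub>F x in at_top. g x * g x \<noteq> 0" using nz by eventually_elim simp
      show "\<forall>\<^sub>F x in at_top. deriv (\<lambda>x. f x / g x) x =
          (f' x * g x + (- 1 * (f x * g' x))) / (g x * g x)"
        using D by eventually_elim (rule DERIV_imp_deriv)
    qed
    assume "p \<noteq> 0"
    then have "\<not> (\<forall>\<^sub>F x in at_top. f x / g x = 0)"
      by (simp add: p zero_germ_def germ.abs_eq_iff germ_rel_def del: divide_eq_0_iff)
    moreover have "\<forall>\<^sub>F x in at_top. f x / g x = 0" if "\<forall>\<^sub>F x in at_top. f x = 0"
      using that by eventually_elim simp
    ultimately have "\<not> (\<forall>\<^sub>F x in at_top. f x = 0)" by blast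
    then have f: "\<forall>\<^sub>F x in at_top. f x \<noteq> 0" using nonzero[OF A(1)] by blast
    have "p * abs_germ (\<lambda>x. g x / f x) = 1"
      unfolding p times_germ.abs_eq one_germ_def germ.abs_eq_iff germ_rel_def
      using f nz by eventually_elim simp
    moreover have "abs_germ (\<lambda>x. g x / f x) \<in> ?H" by (rule I[OF A(2,1) f]) simp
    ultimately show "\<exists>q\<in>?H. p * q = 1" by blast
  qed
qed

section \<open>Incompatible Hardy fields\<close>

text \<open>Taking a power of \<open>S\<close> costs one unit of the argument, passing from
  \<open>S\<close> to \<open>S'\<close> costs \<open>c\<close> more, and monotonicity of
  \<open>S'\<close> absorbs the rest.\<close>

lemma dominates_delay_solution:
  assumes S: "delay_solution a S" and S': "delay_solution a S'"
    and le: "\<And>x. a < x \<Longrightarrow> S x \<le> S' (x + c)"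
    and p: "filterlim p at_top at_top" and q: "\<forall>\<^sub>F x in at_top. p x + 1 + c \<le> q x"
  shows "dominates (\<lambda>x. S' (q x)) (\<lambda>x. S (p x))"
  unfolding dominates_def
proof
  fix n
  have "\<forall>\<^sub>F y in at_top. S (y + 1 - 1) ^ n \<le> S (y + 1)"
    by (rule eventually_compose_filterlim[OF delay_solution_power_le[OF S]])
      (simp add: filterlim_tendsto_add_at_top[OF tendsto_const[of 1] filterlim_ident, simplified add.commute])
  then have "\<forall>\<^sub>F x in at_top. S (p x) ^ n \<le> S (p x + 1)"
    using eventually_compose_filterlim[OF _ p] by fastforce
  \<comment> \<open>Puts both \<open>p x + 1\<close> and \<open>p x + 1 + c\<close> beyond
    \<open>a\<close>.\<close>
  moreover have "\<forall>\<^sub>F x in at_top. max a (a - c) < p x"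
    using p unfolding filterlim_at_top_dense by blast
  ultimately show "\<forall>\<^sub>F x in at_top. \<bar>S (p x)\<bar> ^ n \<le> S' (q x)"
    using q
  proof eventually_elim
    case (elim x)
    have "\<bar>S (p x)\<bar> ^ n \<le> S (p x + 1)" using elim delay_solution_pos[OF S, of "p x"] by simp
    also have "\<dots> \<le> S' (p x + 1 + c)" using elim by (intro le) simp
    also have "\<dots> \<le> S' (q x)" using elim by (intro delay_solution_mono[OF S']) auto
    finally show ?case .
  qed
qed

lemma filterlim_affine_at_top:
  "0 < (r::real) \<Longrightarrow> filterlim (\<lambda>x. r * x - c) at_top at_top"
  using filterlim_tendsto_add_at_top[OF tendsto_const[of "- c"]
      filterlim_tendsto_pos_mult_at_top[OF tendsto_const[of r] _ filterlim_ident]]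
  by simp

text \<open>The meeting points serve twice: they keep the solutions comparable up to a shift by 1,
  and they give the difference zeros arbitrarily far out.\<close>

locale delay_solutions_meeting =
  fixes a :: real and Z W :: "real \<Rightarrow> real"
  assumes Z: "delay_solution a Z" and W: "delay_solution a W"
    and meet: "\<And>x. a \<le> x \<Longrightarrow> \<exists>y\<in>{x..x+1}. Z y = W y"
    and not_eq: "\<not> (\<forall>\<^sub>F x in at_top. Z x = W x)"
begin

text \<open>\<open>B\<close> collects the scales at which \<open>W\<close> replaces
  \<open>Z\<close>. The delays \<open>k\<close> are included because differentiation raises
  \<open>k\<close> by 1.\<close>

definition choice :: "real set \<Rightarrow> real \<Rightarrow> nat \<Rightarrow> real \<Rightarrow> real"
  where "choice B r k x = (if r \<in> B then W else Z) (r * x - real k)"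

definition choices :: "real set \<Rightarrow> (real \<Rightarrow> real) set"
  where "choices B = {choice B r k | r k. 0 < r}"

lemma delay_solution_choice: "delay_solution a (if r \<in> B then W else Z)"
  using Z W by simp

lemma choice_at_top: "0 < r \<Longrightarrow> filterlim (choice B r k) at_top at_top"
  unfolding choice_def
  by (intro filterlim_compose[OF delay_solution_at_top[OF delay_solution_choice]]
      filterlim_affine_at_top)

text \<open>Both solutions are nondecreasing beyond \<open>a\<close>, so the comparison passes
  through a meeting point in \<open>{x..x+1}\<close>.\<close>

lemma shifted_le:
  assumes "a < x" "S \<in> {Z, W}" "S' \<in> {Z, W}"
  shows "S x \<le> S' (x + 1)"
proof -
  have S: "delay_solution a S" "delay_solution a S'" using assms Z W by auto
  obtain y where y: "y \<in> {x..x+1}" "Z y = W y" using meet[of x] assms(1) by auto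
  have "S x \<le> S y" using delay_solution_mono[OF S(1) assms(1)] y by auto
  also have "S y = S' y" using assms y by auto
  also have "\<dots> \<le> S' (x + 1)" using delay_solution_mono[OF S(2), of y "x + 1"] assms(1) y by auto
  finally show ?thesis .
qed

lemma choice_dominates:
  assumes r: "0 < r" and less: "r < r' \<or> r = r' \<and> l < k"
  shows "dominates (choice B r' l) (choice B r k)"
  using less
proof
  assume "r < r'"
  \<comment> \<open>Of the 2 units, one pays for the powers and one for a possible change between
    \<open>Z\<close> and \<open>W\<close>. At equal scales no change occurs and one unit
    suffices.\<close>
  have "\<forall>\<^sub>F x in at_top. real l - real k + 2 \<le> (r' - r) * x - 0"
    using filterlim_affine_at_top[of "r' - r" 0] \<open>r < r'\<close> unfolding filterlim_at_top by simp
  then have "\<forall>\<^sub>F x in at_top. r * x - real k + 1 + 1 \<le> r' * x - real l"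
    by eventually_elim (simp add: algebra_simps)
  then show ?thesis unfolding choice_def[abs_def]
    by (intro dominates_delay_solution[where a = a and S = "if r \<in> B then W else Z" and c = 1
          and S' = "if r' \<in> B then W else Z"]
        filterlim_affine_at_top r shifted_le) (auto simp: Z W)
next
  assume eq: "r = r' \<and> l < k"
  show ?thesis unfolding choice_def[abs_def] eq[THEN conjunct1]
    by (intro dominates_delay_solution[where a = a and S = "if r' \<in> B then W else Z" and c = 0
          and S' = "if r' \<in> B then W else Z"] filterlim_affine_at_top)
      (use eq r in \<open>auto simp: Z W\<close>)
qed

lemma choice_has_derivative:
  assumes r: "0 < r"
  shows "\<exists>v\<in>poly_alg (choices B). \<forall>\<^sub>F x in at_top. (choice B r k has_real_derivative v x) (at x)"
proof (intro bexI)
  let ?S = "if r \<in> B then W else Z"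
  have "\<forall>\<^sub>F x in at_top. a < r * x - real k"
    using filterlim_affine_at_top[OF r, of "real k"] unfolding filterlim_at_top_dense by simp
  then show "\<forall>\<^sub>F x in at_top. (choice B r k has_real_derivative
      r * (choice B r k x * choice B r (Suc k) x)) (at x)"
  proof eventually_elim
    case (elim x)
    have "((\<lambda>x. r * x - real k) has_real_derivative r) (at x)"
      by (auto intro!: derivative_eq_intros)
    from DERIV_chain2[OF delay_solution_DERIV[OF delay_solution_choice[of r B] elim] this]
    have "((\<lambda>x. ?S (r * x - real k)) has_real_derivative
        ?S (r * x - real k) * ?S (r * x - real k - 1) * r) (at x)" .
    moreover have "choice B r k = (\<lambda>x. ?S (r * x - real k))" by (simp add: fun_eq_iff choice_def)
    moreover have "r * x - real (Suc k) = r * x - real k - 1" by simp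
    ultimately show ?case by (simp only: choice_def mult.commute[of r])
  qed
  show "(\<lambda>x. r * (choice B r k x * choice B r (Suc k) x)) \<in> poly_alg (choices B)"
    by (intro poly_alg.mult poly_alg.const poly_alg.gen) (use r in \<open>auto simp: choices_def\<close>)
qed

text \<open>Only the undelayed germs are recorded; they suffice to recover which positive scales lie
  in \<open>B\<close>.\<close>

lemma exists_maximal_Hardy_field_choices:
  "\<exists>M. maximal_Hardy_field M \<and> (\<forall>r>0. abs_germ (choice B r 0) \<in> M)"
proof -
  let ?A = "poly_alg (choices B)"
  let ?H = "{abs_germ (\<lambda>x. f x / g x) | f g. f \<in> ?A \<and> g \<in> ?A \<and> (\<forall>\<^sub>F x in at_top. g x \<noteq> 0)}"
  have "dominates u v \<or> dominates v u" if uv: "u \<in> choices B" "v \<in> choices B" "u \<noteq> v" for u v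
  proof -
    obtain r k s l where u: "u = choice B r k" "0 < r" and v: "v = choice B s l" "0 < s"
      using uv by (auto simp: choices_def)
    then have "r < s \<or> s < r \<or> r = s \<and> (k < l \<or> l < k)" using uv(3) by auto
    then show ?thesis using choice_dominates u v by auto
  qed
  then have nonzero: "(\<forall>\<^sub>F x in at_top. f x = 0) \<or> (\<forall>\<^sub>F x in at_top. f x \<noteq> 0)" if "f \<in> ?A" for f
    by (rule poly_alg_zero_or_nonzero[rotated, OF _ that])
      (auto simp: choices_def intro: choice_at_top)
  have deriv: "\<exists>g\<in>?A. \<forall>\<^sub>F x in at_top. (f has_real_derivative g x) (at x)" if "f \<in> ?A" for f
    by (rule poly_alg_derivative[OF that])
      (unfold choices_def, use choice_has_derivative[unfolded choices_def] in blast)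
  have "Hardy_field ?H"
    by (rule Hardy_field_fractions)
      (rule poly_alg.const | erule (1) poly_alg.add poly_alg.mult | erule nonzero deriv)+
  then obtain M where M: "maximal_Hardy_field M" "?H \<subseteq> M"
    by (rule subset_maximal_Hardy_field)
  have "abs_germ (choice B r 0) \<in> ?H" if "0 < r" for r
    by (intro CollectI exI[of _ "choice B r 0"] exI[of _ "\<lambda>_. 1"])
      (use that in \<open>auto simp: choices_def intro: poly_alg.gen poly_alg.const\<close>)
  then show ?thesis using M by blast
qed

text \<open>The difference is not eventually zero, yet it vanishes arbitrarily far out, so it has no
  inverse in a Hardy field.\<close>

lemma incompatible:
  assumes H: "Hardy_field H" and r: "0 < r"
    and mem: "abs_germ (\<lambda>x. Z (r * x)) \<in> H" "abs_germ (\<lambda>x. W (r * x)) \<in> H"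
  shows False
proof -
  let ?f = "\<lambda>x. Z (r * x) - W (r * x)"
  have "abs_germ (\<lambda>x. Z (r * x)) + - abs_germ (\<lambda>x. W (r * x)) \<in> H"
    using H mem unfolding Hardy_field_iff by blast
  then have "abs_germ ?f \<in> H" by (simp add: uminus_germ.abs_eq plus_germ.abs_eq)
  moreover have "\<not> (\<forall>\<^sub>F x in at_top. ?f x = 0)"
  proof
    assume "\<forall>\<^sub>F x in at_top. ?f x = 0"
    \<comment> \<open>Substituting \<open>x / r\<close> undoes the scaling.\<close>
    moreover have "filterlim (\<lambda>x. inverse r * x - 0) at_top at_top"
      using r by (intro filterlim_affine_at_top) simp
    ultimately have "\<forall>\<^sub>F x in at_top. ?f (inverse r * x - 0) = 0"
      by (rule eventually_compose_filterlim)
    moreover have "r * (inverse r * x - 0) = x" for x using r by simp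
    ultimately have "\<forall>\<^sub>F x in at_top. Z x - W x = 0" by (simp only:)
    then show False using not_eq by simp
  qed
  ultimately have "\<forall>\<^sub>F x in at_top. ?f x \<noteq> 0" by (rule Hardy_field_eventually_nonzero[OF H])
  then obtain c where c: "\<And>x. c \<le> x \<Longrightarrow> ?f x \<noteq> 0" by (auto simp: eventually_at_top_linorder)
  obtain y where "y \<ge> max a (r * c)" "Z y = W y" using meet[of "max a (r * c)"] by auto
  then show False using c[of "y / r"] r by (simp add: field_simps)
qed

lemma Pow_ordLeq_maximal_Hardy_fields: "|Pow {0::real<..}| \<le>o |{H. maximal_Hardy_field H}|"
proof -
  obtain M where M: "\<And>B. maximal_Hardy_field (M B)"
    "\<And>B r. 0 < r \<Longrightarrow> abs_germ (choice B r 0) \<in> M B"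
    using exists_maximal_Hardy_field_choices by metis
  \<comment> \<open>One inclusion is enough for injectivity, since the assumption is symmetric in
    \<open>B\<close> and \<open>C\<close>.\<close>
  have sub: "B \<subseteq> C" if eq: "M B = M C" and B: "B \<subseteq> {0<..}" for B C
  proof (rule subsetI, rule ccontr)
    fix r assume "r \<in> B" "r \<notin> C"
    then have "0 < r" "choice B r 0 = (\<lambda>x. W (r * x))" "choice C r 0 = (\<lambda>x. Z (r * x))"
      using B by (auto simp: choice_def fun_eq_iff)
    then show False
      using incompatible[of "M B" r] M(1)[of B] M(2)[of r B] M(2)[of r C] eq
      by (simp add: maximal_Hardy_field_def)
  qed
  have "inj_on M (Pow {0<..})" by (rule inj_onI) (use sub in blast)
  moreover have "M ` Pow {0<..} \<subseteq> {H. maximal_Hardy_field H}" using M(1) by auto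
  ultimately show ?thesis using card_of_ordLeq by blast
qed

end

section \<open>Cardinalities\<close>

lemma isCont_eq_if_eq_on_rats:
  fixes f g :: "real \<Rightarrow> real"
  assumes "isCont f x" "isCont g x" "c < x" and eq: "\<And>q. c < q \<Longrightarrow> q \<in> \<rat> \<Longrightarrow> f q = g q"
  shows "f x = g x"
proof (rule ccontr)
  assume "f x \<noteq> g x"
  moreover have "isCont (\<lambda>y. f y - g y) x" using assms by (intro continuous_intros)
  then have "((\<lambda>y. f y - g y) \<longlongrightarrow> f x - g x) (nhds x)"
    using tendsto_at_iff_tendsto_nhds[of "\<lambda>y. f y - g y" x] by (simp add: isCont_def)
  ultimately have "\<forall>\<^sub>F y in nhds x. f y - g y \<noteq> 0"
    by (intro tendsto_imp_eventually_ne[of _ "f x - g x"]) auto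
  then obtain S where S: "open S" "x \<in> S" "\<And>y. y \<in> S \<Longrightarrow> f y \<noteq> g y"
    by (auto simp: eventually_nhds)
  have "open (S \<inter> {c<..})" "x \<in> S \<inter> {c<..}" using S assms(3) by auto
  then have "S \<inter> {c<..} \<inter> \<rat> \<noteq> {}"
    using open_Int_closure_eq_empty[of "S \<inter> {c<..}" \<rat>] by (auto simp: Rats_closure_real)
  then show False using S(3) eq by auto
qed

lemma differentiable_germs_ordLeq:
  "|{g. differentiable_germ g}| \<le>o |UNIV :: (rat \<times> rat) set set|"
proof -
  have "\<exists>f b. g = abs_germ f \<and> (\<forall>x>b. isCont f x)" if "differentiable_germ g" for g
  proof -
    have "\<forall>\<^sub>F x in at_top. rep_germ g differentiable (at x)"
      using that by (simp add: differentiable_germ.rep_eq)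
    then have "\<exists>b. \<forall>x>b. isCont (rep_germ g) x"
      by (auto simp: eventually_at_top_dense intro: differentiable_imp_continuous_within)
    moreover have "g = abs_germ (rep_germ g)"
      by (simp add: Quotient3_abs_rep[OF Quotient3_germ])
    ultimately show ?thesis by blast
  qed
  then obtain f b where f: "\<And>g. differentiable_germ g \<Longrightarrow> g = abs_germ (f g)"
    and b: "\<And>g x. differentiable_germ g \<Longrightarrow> b g < x \<Longrightarrow> isCont (f g) x" by metis
  \<comment> \<open>Encodes the values at all rational points by their lower Dedekind cuts. Rational
    points before \<open>b g\<close> are included without harm, since the representative
    \<open>f g\<close> is fixed for each germ.\<close>
  define cut where "cut g = {(q, p). real_of_rat p < f g (real_of_rat q)}" for g
  have "inj_on cut {g. differentiable_germ g}"
  proof (rule inj_onI, unfold mem_Collect_eq)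
    fix g h assume gh: "differentiable_germ g" "differentiable_germ h" and eq: "cut g = cut h"
    have "f g (real_of_rat q) = f h (real_of_rat q)" for q
    proof -
      have *: "real_of_rat p < f g (real_of_rat q) \<longleftrightarrow> real_of_rat p < f h (real_of_rat q)" for p
        using eq by (auto simp: cut_def set_eq_iff)
      show ?thesis
        by (rule linorder_cases[of "f g (real_of_rat q)" "f h (real_of_rat q)"])
          (use * of_rat_dense in \<open>blast dest: less_asym\<close>)+
    qed
    then have "f g x = f h x" if "max (b g) (b h) < x" for x
      using isCont_eq_if_eq_on_rats[OF b[OF gh(1)] b[OF gh(2)] that] that by (auto elim!: Rats_cases)
    then have "abs_germ (f g) = abs_germ (f h)"
      unfolding germ.abs_eq_iff germ_rel_def eventually_at_top_dense by blast
    then show "g = h" using f gh by simp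
  qed
  then show ?thesis using card_of_ordLeq by blast
qed

lemma Pow_ordIso_ctwo_cexp:
  fixes r :: "'b rel"
  assumes "|A| =o r"
  shows "|Pow A| =o ctwo ^c r"
proof -
  have "|Pow A| =o ctwo ^c |A|"
    using card_of_Pow_Func by (simp add: cexp_def ctwo_def Field_card_of)
  also have "ctwo ^c |A| =o ctwo ^c r"
    by (rule cexp_cong2[OF assms Card_order_ctwo card_of_Card_order])
  finally show ?thesis .
qed

text \<open>The cardinal \<open>ctwo ^c natLeq\<close> is the continuum.\<close>

lemma card_of_countable_UNIV_set:
  assumes "infinite (UNIV :: 'a :: countable set)"
  shows "|UNIV :: 'a set set| =o ctwo ^c natLeq"
proof -
  have "bij_betw (to_nat_on (UNIV :: 'a set)) UNIV UNIV"
    using assms by (intro to_nat_on_infinite) auto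
  then have "|UNIV :: 'a set| =o |UNIV :: nat set|" using card_of_ordIso by blast
  also have "|UNIV :: nat set| =o natLeq" by (rule card_of_nat)
  finally have "|Pow (UNIV :: 'a set)| =o ctwo ^c natLeq" by (rule Pow_ordIso_ctwo_cexp)
  then show ?thesis by simp
qed

lemma card_of_positive_reals: "|{0::real<..}| =o ctwo ^c natLeq"
proof -
  have "bij_betw ln {0::real<..} UNIV"
    by (rule bij_betw_byWitness[where f' = exp]) auto
  then have "|{0::real<..}| =o |UNIV :: real set|" using card_of_ordIso by blast
  also have "|UNIV :: real set| =o |UNIV :: nat set set|"
    using eqpoll_iff_card_of_ordIso eqpoll_sym[OF nat_sets_eqpoll_reals] by blast
  also have "|UNIV :: nat set set| =o ctwo ^c natLeq"
    by (rule card_of_countable_UNIV_set) (rule infinite_UNIV_nat)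
  finally show ?thesis .
qed

theorem theorem7p1:
  shows "|{H. maximal_Hardy_field H}| =o ctwo ^c (ctwo ^c natLeq)"
proof -
  let ?D = "{g. differentiable_germ g}" and ?X = "UNIV :: (rat \<times> rat) set set"
  obtain a Z W where "delay_solutions_meeting a Z W"
    using exists_delay_solutions_meeting_repeatedly unfolding delay_solutions_meeting_def by metis
  then have lower: "|Pow {0::real<..}| \<le>o |{H. maximal_Hardy_field H}|"
    by (rule delay_solutions_meeting.Pow_ordLeq_maximal_Hardy_fields)
  obtain \<phi> :: "germ \<Rightarrow> (rat \<times> rat) set" where \<phi>: "inj_on \<phi> ?D"
    using differentiable_germs_ordLeq unfolding card_of_ordLeq[symmetric] by blast
  \<comment> \<open>Hardy fields are sets of differentiable germs, so an injective code for these
    germs yields one for Hardy fields by taking images.\<close>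
  have "{H. maximal_Hardy_field H} \<subseteq> Pow ?D"
    by (auto simp: maximal_Hardy_field_def Hardy_field_iff)
  then have "inj_on ((`) \<phi>) {H. maximal_Hardy_field H}"
    using inj_on_image_Pow[OF \<phi>(1)] inj_on_subset by blast
  then have upper: "|{H. maximal_Hardy_field H}| \<le>o |Pow ?X|"
    by (intro card_of_ordLeqI) auto
  have inf: "infinite (UNIV :: (rat \<times> rat) set)"
    by (simp add: finite_prod infinite_UNIV_char_0)
  note X = Pow_ordIso_ctwo_cexp[OF card_of_countable_UNIV_set[OF inf]]
  note R = Pow_ordIso_ctwo_cexp[OF card_of_positive_reals]
  show ?thesis
    unfolding ordIso_iff_ordLeq
    using ordLeq_ordIso_trans[OF upper X] ordIso_ordLeq_trans[OF ordIso_symmetric[OF R] lower]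
    by blast
qed

end
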